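(* Let $n\ge1$, let $w:(0,\infty)\to\mathbb{R}$ be $C^{1}$-smooth and increasing, and let $\nu$ be an even finite measure on $\mathbb{R}^n$ which is log-concave with respect to the measure $e^{-w(|x|)}\,dx$. Then for every $C^{1}$-smooth and odd function $h:\mathbb{R}^{n}\to\mathbb{R}$ we have $$\int\frac{w'(|x|)}{|x|}\,h(x)^{2}\,d\nu(x)\le\int|\nabla h(x)|^{2}\,d\nu(x).$$
   Context: $|\cdot|$ is the standard Euclidean norm on $\mathbb{R}^n$. "Increasing" is understood in the weak sense (non-decreasing). A measure $\nu$ is log-concave with respect to a measure $\mu$ if $d\nu(x)=e^{-v(x)}\,d\mu(x)$ for some convex $v:\mathbb{R}^n\to\mathbb{R}\cup\{+\infty\}$. A measure $\nu$ is even if $\nu(-B)=\nu(B)$ for all Borel sets $B$. Both integrals are of nonnegative functions and take values in $[0,+\infty]$. *)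

theory Defs
  imports "HOL-Analysis.Analysis"
begin

text \<open>Convexity for functions with values in the reals extended by plus infinity.  In \<^typ>\<open>ereal\<close>
  we have \<open>0 * \<infinity> = 0\<close>, so the inequality is trivially true for \<open>t = 0\<close> and \<open>t = 1\<close>.\<close>

definition ext_convex :: "('a::real_vector \<Rightarrow> ereal) \<Rightarrow> bool" where
  "ext_convex v \<longleftrightarrow>
     (\<forall>x. v x \<noteq> -\<infinity>) \<and>
     (\<forall>x y. \<forall>t\<in>{0..1}.
        v ((1 - t) *\<^sub>R x + t *\<^sub>R y) \<le> ereal (1 - t) * v x + ereal t * v y)"

text \<open>The function \<open>a \<mapsto> exp (-a)\<close>, only meant for \<open>a \<noteq> -\<infinity>\<close>.\<close>

definition exp_minus :: "ereal \<Rightarrow> ennreal" where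
  "exp_minus a = (if a = \<infinity> then 0 else ennreal (exp (- real_of_ereal a)))"

text \<open>A convex function with values in the extended reals need not be Borel on the boundary of its
  domain, which is why the density is taken to be measurable for the completion of \<open>\<mu>\<close>.\<close>

definition log_concave_wrt :: "'a::real_vector measure \<Rightarrow> 'a measure \<Rightarrow> bool" where
  "log_concave_wrt \<nu> \<mu> \<longleftrightarrow>
     sets \<nu> = sets \<mu> \<and>
     (\<exists>v. ext_convex v \<and>
          (\<lambda>x. exp_minus (v x)) \<in> borel_measurable (completion \<mu>) \<and>
          (\<forall>A\<in>sets \<mu>. emeasure \<nu> A = (\<integral>\<^sup>+x\<in>A. exp_minus (v x) \<partial>completion \<mu>)))"

definition even_measure :: "'a::{uminus, topological_space} measure \<Rightarrow> bool" where
  "even_measure \<nu> \<longleftrightarrow> (\<forall>B\<in>sets borel. emeasure \<nu> (uminus ` B) = emeasure \<nu> B)"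

end

theory Submission
  imports Defs
begin

text \<open>Write \<open>\<mu>\<close> for the even log-concave measure \<open>e\<^sup>-\<^sup>v dx\<close>.  By the Prekopa-Leindler inequality and evenness,
  \<open>\<mu> A \<le> \<mu> B\<close> whenever \<open>(A - A)/2 \<subseteq> B\<close>.  Put \<open>q x = |x|\<^sup>2 - 2\<epsilon> h x + \<epsilon>\<^sup>2 |\<nabla>h x|\<^sup>2\<close>.  As \<open>h\<close> is odd, the parallelogram law
  and \<open>h x + h y \<approx> \<langle>\<nabla>h x, x + y\<rangle>\<close> give \<open>|(x - y)/2|\<^sup>2 \<le> (q x + q y)/2\<close> up to \<open>o(\<epsilon>\<^sup>2)\<close>, the difference being
  the square of \<open>|x + y - 2\<epsilon> \<nabla>h x| / 2\<close>.  Hence \<open>\<integral> \<Phi>(q x) d\<mu> \<le> \<integral> \<Phi>(|x|\<^sup>2) d\<mu>\<close> for every decreasing \<open>\<Phi>\<close>.  The first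
  order term in \<open>\<epsilon>\<close> vanishes by oddness, and the second order term reads
  \<open>\<integral> 2 \<Phi>''(|x|\<^sup>2) h\<^sup>2 d\<mu> \<le> \<integral> -\<Phi>'(|x|\<^sup>2) |\<nabla>h|\<^sup>2 d\<mu>\<close>.  The theorem is the limiting case \<open>-\<Phi>'(r\<^sup>2) = e\<^bsup>-w(r)\<^esup>\<close>, and
  no derivative of \<open>v\<close> is ever taken.\<close>

section \<open>The Prekopa-Leindler inequality for midpoints\<close>

text \<open>Lebesgue measure is infinite, so inner regularity is applied to its finite restrictions
  to balls, whose radius then tends to infinity.\<close>

lemma emeasure_lborel_inner_compact:
  fixes A :: "'a::euclidean_space set"
  assumes A: "A \<in> sets borel"
  shows "emeasure lborel A = (SUP K\<in>{K. K \<subseteq> A \<and> compact K}. emeasure lborel K)"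
proof (rule antisym)
  have "emeasure lborel (A \<inter> cball 0 (real n)) \<le> (SUP K\<in>{K. K \<subseteq> A \<and> compact K}. emeasure lborel K)" for n
  proof -
    define M where "M = density lborel (indicator (cball (0::'a) (real n)))"
    have M: "emeasure M B = emeasure lborel (B \<inter> cball 0 (real n))" if "B \<in> sets borel" for B
    proof -
      have "emeasure M B = (\<integral>\<^sup>+x. indicator (cball 0 (real n)) x * indicator B x \<partial>lborel)"
        using that unfolding M_def
        by (intro emeasure_density) (auto intro!: borel_measurable_indicator borel_closed)
      also have "\<dots> = (\<integral>\<^sup>+x. indicator (B \<inter> cball 0 (real n)) x \<partial>lborel)"
        by (intro nn_integral_cong) (auto simp: indicator_def)
      finally have "emeasure M B = (\<integral>\<^sup>+x. indicator (B \<inter> cball 0 (real n)) x \<partial>lborel)" .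
      then show ?thesis using that by simp
    qed
    have space: "space M = UNIV" by (simp add: M_def)
    have "emeasure M A = (SUP K\<in>{K. K \<subseteq> A \<and> compact K}. emeasure M K)"
    proof (rule inner_regular)
      show "emeasure M (space M) \<noteq> \<infinity>"
        using M[of UNIV] less_imp_neq[OF emeasure_lborel_cball_finite[of "0::'a" "real n"]]
        by (simp add: space)
    qed (use A in \<open>auto simp: M_def\<close>)
    also have "\<dots> \<le> (SUP K\<in>{K. K \<subseteq> A \<and> compact K}. emeasure lborel K)"
    proof (rule SUP_subset_mono[OF order_refl])
      fix K assume "K \<in> {K. K \<subseteq> A \<and> compact K}"
      then have "K \<in> sets borel" by (auto intro: borel_closed compact_imp_closed)
      then show "emeasure M K \<le> emeasure lborel K" by (subst M) (auto intro: emeasure_mono)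
    qed
    finally show ?thesis using A by (simp add: M)
  qed
  moreover have "emeasure lborel A = (SUP n. emeasure lborel (A \<inter> cball 0 (real n)))"
  proof -
    have "A = (\<Union>n. A \<inter> cball 0 (real n))"
      using real_arch_simple by (auto simp: dist_norm)
    moreover have "(SUP n. emeasure lborel (A \<inter> cball 0 (real n))) = emeasure lborel (\<Union>n. A \<inter> cball 0 (real n))"
      by (rule SUP_emeasure_incseq) (use A in \<open>auto simp: incseq_def\<close>)
    ultimately show ?thesis by simp
  qed
  ultimately show "emeasure lborel A \<le> (SUP K\<in>{K. K \<subseteq> A \<and> compact K}. emeasure lborel K)"
    by (simp add: SUP_le_iff)
qed (use A in \<open>auto intro!: SUP_least emeasure_mono\<close>)

lemma emeasure_lborel_affine_vimage_real:
  fixes c t :: real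
  assumes A: "A \<in> sets borel" and c: "c \<noteq> 0"
  shows "emeasure lborel A = ennreal \<bar>c\<bar> * emeasure lborel ((\<lambda>x. t + c * x) -` A)"
proof -
  have V: "(\<lambda>x. t + c * x) -` A \<in> sets borel"
    using measurable_sets[of "\<lambda>x. t + c * x" borel borel A] A by simp
  have "emeasure lborel A = (\<integral>\<^sup>+x. indicator A x \<partial>lborel)" using A by simp
  also have "\<dots> = ennreal \<bar>c\<bar> * (\<integral>\<^sup>+x. indicator A (t + c * x) \<partial>lborel)"
    by (rule nn_integral_real_affine) (use A c in auto)
  also have "(\<integral>\<^sup>+x. indicator A (t + c * x) \<partial>lborel) = (\<integral>\<^sup>+x. indicator ((\<lambda>x. t + c * x) -` A) x \<partial>lborel)"
    by (intro nn_integral_cong) (simp add: indicator_def)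
  finally show ?thesis using V by simp
qed

text \<open>For nonempty compact \<open>K\<close> and \<open>L\<close>, the translates of
  \<open>K\<close> by \<open>min L\<close> and of \<open>L\<close> by \<open>max K\<close> both lie
  in the double of \<open>C\<close> and meet in at most one point, so their lengths add. Inner
  regularity passes from compact to Borel sets. \<open>C\<close> is only required to contain the
  midpoints, so measurability of the sumset is never an issue.\<close>

lemma brunn_minkowski_real:
  fixes A B C :: "real set"
  assumes A: "A \<in> sets borel" "A \<noteq> {}" and B: "B \<in> sets borel" "B \<noteq> {}" and C: "C \<in> sets borel"
    and mid: "\<And>x y. x \<in> A \<Longrightarrow> y \<in> B \<Longrightarrow> (x + y) / 2 \<in> C"
  shows "emeasure lborel A + emeasure lborel B \<le> 2 * emeasure lborel C"
proof -
  define D where "D = (\<lambda>x. x / 2) -` C"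
  have D: "D \<in> sets borel"
    unfolding D_def using measurable_sets[of "\<lambda>x::real. x / 2" borel borel C] C by simp
  have D2: "emeasure lborel D = 2 * emeasure lborel C"
  proof -
    have "(\<lambda>x. 0 + 2 * x) -` D = C" by (auto simp: D_def)
    then show ?thesis using emeasure_lborel_affine_vimage_real[OF D, of 2 0] by simp
  qed
  have *: "emeasure lborel K + emeasure lborel L \<le> emeasure lborel D"
    if K: "K \<subseteq> A" "compact K" "K \<noteq> {}" and L: "L \<subseteq> B" "compact L" "L \<noteq> {}" for K L
  proof -
    obtain a where a: "a \<in> K" "\<And>x. x \<in> K \<Longrightarrow> x \<le> a"
      using compact_attains_sup[OF K(2,3)] by auto
    obtain b where b: "b \<in> L" "\<And>x. x \<in> L \<Longrightarrow> b \<le> x"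
      using compact_attains_inf[OF L(2,3)] by auto
    let ?K = "(\<lambda>x. x - b) -` K" and ?L = "(\<lambda>x. x - a) -` L"
    have KL: "K \<in> sets borel" "L \<in> sets borel"
      using K L by (auto intro: borel_closed compact_imp_closed)
    have KL': "?K \<in> sets borel" "?L \<in> sets borel"
      using measurable_sets[of "\<lambda>x::real. x - b" borel borel K] measurable_sets[of "\<lambda>x::real. x - a" borel borel L] KL
      by simp_all
    have "x \<in> D" if "x \<in> ?K" for x
      using mid[of "x - b" b] that b K L by (auto simp: D_def)
    moreover have "x \<in> D" if "x \<in> ?L" for x
      using mid[of a "x - a"] that a K L by (auto simp: D_def)
    ultimately have sub: "?K \<union> ?L \<subseteq> D" by auto
    have int: "?K \<inter> ?L \<subseteq> {a + b}"
    proof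
      fix x assume "x \<in> ?K \<inter> ?L"
      then have "x - b \<le> a" "b \<le> x - a" using a b by auto
      then show "x \<in> {a + b}" by auto
    qed
    have "emeasure lborel (?K \<inter> ?L) \<le> emeasure lborel {a + b}"
      by (rule emeasure_mono[OF int]) simp
    then have "emeasure lborel (?K \<inter> ?L) = 0" by simp
    then have "?K \<inter> ?L \<in> null_sets lborel" using KL' by auto
    then have "emeasure lborel (?K \<union> ?L) = emeasure lborel ?K + emeasure lborel ?L"
      using KL' by (intro emeasure_Un') auto
    then show ?thesis
      using emeasure_mono[OF sub, of lborel] D
        emeasure_lborel_affine_vimage_real[OF KL(1), of 1 "- b"] emeasure_lborel_affine_vimage_real[OF KL(2), of 1 "- a"]
      by simp
  qed
  have ne: "{K. K \<subseteq> S \<and> compact K} \<noteq> {}" for S :: "real set" by (auto intro!: exI[of _ "{}"])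
  \<comment> \<open>Adding a point of \<open>S\<close> disposes of empty compact sets; this is where
    nonemptiness of \<open>A\<close> and \<open>B\<close> enters.\<close>
  have ext: "\<exists>K'. K \<subseteq> K' \<and> K' \<subseteq> S \<and> compact K' \<and> K' \<noteq> {}" if "K \<subseteq> S" "compact K" "S \<noteq> {}" for K S :: "real set"
    using that by (metis all_not_in_conv compact_insert insert_not_empty insert_subset subset_insertI)
  have **: "emeasure lborel K + emeasure lborel L \<le> emeasure lborel D"
    if K: "K \<subseteq> A" "compact K" and L: "L \<subseteq> B" "compact L" for K L
  proof -
    obtain K' where K': "K \<subseteq> K'" "K' \<subseteq> A" "compact K'" "K' \<noteq> {}" using ext[OF K A(2)] by blast
    obtain L' where L': "L \<subseteq> L'" "L' \<subseteq> B" "compact L'" "L' \<noteq> {}" using ext[OF L B(2)] by blast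
    have "emeasure lborel K + emeasure lborel L \<le> emeasure lborel K' + emeasure lborel L'"
      using K' L' by (intro add_mono emeasure_mono) (auto intro: borel_closed compact_imp_closed)
    then show ?thesis using *[OF K'(2-4) L'(2-4)] by (rule order_trans)
  qed
  show ?thesis
    unfolding D2[symmetric] emeasure_lborel_inner_compact[OF A(1)] emeasure_lborel_inner_compact[OF B(1)]
    unfolding ennreal_SUP_add_left[OF ne, symmetric] ennreal_SUP_add_right[OF ne]
    using ** by (intro SUP_least) auto
qed

section \<open>From superlevel sets to the Prekopa-Leindler inequality on the line\<close>

text \<open>The value \<open>f x\<close> is the length of the set of levels \<open>t\<close> with
  \<open>0 < t < f x\<close>, also when it is infinite; Tonelli then exchanges levels and
  points.\<close>

lemma (in sigma_finite_measure) nn_integral_layer_cake: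
  assumes f[measurable]: "f \<in> borel_measurable M"
  shows "(\<integral>\<^sup>+x. f x \<partial>M) =
    (\<integral>\<^sup>+t. indicator {0<..} t * emeasure M {x\<in>space M. ennreal t < f x} \<partial>lborel)"
proof -
  interpret pair_sigma_finite lborel M by standard
  have fx: "c = (\<integral>\<^sup>+t. indicator {t. 0 < t \<and> ennreal t < c} t \<partial>lborel)" for c :: ennreal
  proof (cases c)
    case (real r)
    then have "{t. 0 < t \<and> ennreal t < c} = {0<..<r}"
      by (auto simp: ennreal_less_iff)
    then show ?thesis using real by simp
  next
    case top
    then have *: "{t. 0 < t \<and> ennreal t < c} = {0<..}" by auto
    have "ennreal (real n) \<le> emeasure lborel {0::real<..}" for n
    proof -
      have "{0<..<real n} \<subseteq> {0<..}" by auto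
      from emeasure_mono[OF this, of lborel] show ?thesis by simp
    qed
    then have "(SUP n. of_nat n :: ennreal) \<le> emeasure lborel {0::real<..}"
      by (intro SUP_least) (simp add: ennreal_of_nat_eq_real_of_nat)
    then have "emeasure lborel {0::real<..} = \<infinity>"
      by (simp add: ennreal_SUP_of_nat_eq_top top_unique)
    with * show ?thesis using top by simp
  qed
  have "(\<integral>\<^sup>+x. f x \<partial>M) = (\<integral>\<^sup>+x. \<integral>\<^sup>+t. indicator {t. 0 < t \<and> ennreal t < f x} t \<partial>lborel \<partial>M)"
    by (subst fx) simp
  also have "\<dots> = (\<integral>\<^sup>+x. \<integral>\<^sup>+t. indicator {0<..} t * indicator {p\<in>space (lborel \<Otimes>\<^sub>M M). ennreal (fst p) < f (snd p)} (t, x) \<partial>lborel \<partial>M)"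
    by (intro nn_integral_cong) (auto simp: indicator_def space_pair_measure)
  also have "\<dots> = (\<integral>\<^sup>+t. \<integral>\<^sup>+x. indicator {0<..} t * indicator {p\<in>space (lborel \<Otimes>\<^sub>M M). ennreal (fst p) < f (snd p)} (t, x) \<partial>M \<partial>lborel)"
    by (rule Fubini') measurable
  also have "\<dots> = (\<integral>\<^sup>+t. indicator {0<..} t * (\<integral>\<^sup>+x. indicator {x\<in>space M. ennreal t < f x} x \<partial>M) \<partial>lborel)"
    by (intro nn_integral_cong) (auto simp: indicator_def space_pair_measure simp flip: nn_integral_cmult intro!: nn_integral_cong)
  finally show ?thesis by simp
qed

text \<open>The arithmetic-geometric mean inequality, infinite values included. It turns the
  additive Brunn-Minkowski bound into a multiplicative one.\<close>

lemma ennreal_mult_le_square: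
  fixes u v k :: ennreal
  assumes "u + v \<le> 2 * k"
  shows "u * v \<le> k\<^sup>2"
proof (cases k)
  case (real r)
  then have "u + v \<noteq> \<infinity>" using assms by (auto simp: top_unique ennreal_mult_eq_top_iff)
  then obtain a b where ab: "u = ennreal a" "v = ennreal b" "0 \<le> a" "0 \<le> b"
    by (cases u; cases v) auto
  then have "ennreal (a + b) \<le> ennreal (2 * r)"
    using assms real by (simp add: ennreal_mult ennreal_plus)
  then have "a + b \<le> 2 * r" using real by (simp add: ennreal_le_iff)
  then have "(a + b)\<^sup>2 \<le> (2 * r)\<^sup>2" using ab by (intro power_mono) auto
  moreover have "0 \<le> (a - b)\<^sup>2" by simp
  ultimately have "a * b \<le> r\<^sup>2" by (simp add: power2_eq_square algebra_simps)
  then show ?thesis using ab real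
    by (simp add: ennreal_power ennreal_le_iff flip: ennreal_mult)
qed (simp add: power2_eq_square)

text \<open>For values of functions it places midpoints of superlevel sets of \<open>f\<close> and
  \<open>g\<close> in the superlevel set of \<open>k\<close> at the same level; for measures of sets
  it replaces taking square roots.\<close>

lemma ennreal_less_of_mult_le_square:
  fixes a b t k :: ennreal
  assumes "t < a" "t < b" "a * b \<le> k\<^sup>2"
  shows "t < k"
proof (rule ccontr)
  assume "\<not> t < k"
  then have "k\<^sup>2 \<le> t * t" by (simp add: power2_eq_square mult_mono)
  moreover have "t * t < a * b"
  proof (cases "t = 0")
    case True
    with assms show ?thesis by (simp add: zero_less_iff_neq_zero)
  next
    case False
    then have "t * t < t * b"
      using assms by (intro ennreal_mult_strict_left_mono) (auto simp: zero_less_iff_neq_zero less_top[symmetric] dest: order.strict_implies_not_eq)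
    also have "t * b \<le> a * b" using assms by (intro mult_right_mono) auto
    finally show ?thesis .
  qed
  ultimately show False using assms(3) by auto
qed

text \<open>Equal suprema make the superlevel sets of \<open>f\<close> and \<open>g\<close> nonempty
  for exactly the same levels among \<open>0 < t < 1\<close>, so Brunn-Minkowski applies there; from
  level 1 on both sets are empty. Integrating over the levels bounds the sum of the integrals, which
  is stronger than the bound on their product.\<close>

lemma prekopa_leindler_real_normalized:
  fixes f g k :: "real \<Rightarrow> ennreal"
  assumes [measurable]: "f \<in> borel_measurable borel" "g \<in> borel_measurable borel" "k \<in> borel_measurable borel"
    and le: "(SUP x. f x) = 1" "(SUP x. g x) = 1"
    and mid: "\<And>x y. f x * g y \<le> (k ((x + y) / 2))\<^sup>2"
  shows "(\<integral>\<^sup>+x. f x \<partial>lborel) * (\<integral>\<^sup>+x. g x \<partial>lborel) \<le> (\<integral>\<^sup>+x. k x \<partial>lborel)\<^sup>2"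
proof (rule ennreal_mult_le_square)
  note lc = lborel.nn_integral_layer_cake[simplified]
  have "indicator {0<..} t * emeasure lborel {x. ennreal t < f x} + indicator {0<..} t * emeasure lborel {x. ennreal t < g x}
      \<le> 2 * (indicator {0<..} t * emeasure lborel {x. ennreal t < k x})" for t :: real
  proof (cases "0 < t \<and> t < 1")
    case True
    then have t: "ennreal t < (SUP x. f x)" "ennreal t < (SUP x. g x)"
      by (auto simp: le ennreal_less_iff simp flip: ennreal_1)
    have "emeasure lborel {x. ennreal t < f x} + emeasure lborel {x. ennreal t < g x}
      \<le> 2 * emeasure lborel {x. ennreal t < k x}"
    proof (rule brunn_minkowski_real)
      show "{x. ennreal t < f x} \<noteq> {}" "{x. ennreal t < g x} \<noteq> {}"
        using t by (auto simp: less_SUP_iff)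
      show "(x + y) / 2 \<in> {x. ennreal t < k x}" if "x \<in> {x. ennreal t < f x}" "y \<in> {x. ennreal t < g x}" for x y
        using that ennreal_less_of_mult_le_square[OF _ _ mid] by simp
    qed simp_all
    then show ?thesis using True by simp
  next
    case False
    have "f x \<le> 1" "g x \<le> 1" for x
      by (metis SUP_upper UNIV_I le(1), metis SUP_upper UNIV_I le(2))
    then have "{x. ennreal t < f x} = {}" "{x. ennreal t < g x} = {}" if "1 \<le> t"
      using that by (metis (no_types, lifting) Collect_empty_eq ennreal_1 ennreal_leI leD order_less_le_trans)+
    with False show ?thesis by (cases "0 < t") auto
  qed
  then show "(\<integral>\<^sup>+x. f x \<partial>lborel) + (\<integral>\<^sup>+x. g x \<partial>lborel) \<le> 2 * (\<integral>\<^sup>+x. k x \<partial>lborel)"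
    unfolding lc[OF assms(1)] lc[OF assms(2)] lc[OF assms(3)]
    by (subst nn_integral_add[symmetric], measurable, subst nn_integral_cmult[symmetric], measurable)
      (auto intro!: nn_integral_mono)
qed

text \<open>The inequality is homogeneous: dividing \<open>f\<close> and \<open>g\<close> by their
  suprema \<open>a\<close> and \<open>b\<close>, and \<open>k\<close> by the geometric mean of
  \<open>a\<close> and \<open>b\<close>, preserves the hypothesis. Boundedness makes the suprema
  finite, and a vanishing supremum makes the left side zero.\<close>

lemma prekopa_leindler_real_bounded:
  fixes f g k :: "real \<Rightarrow> ennreal"
  assumes [measurable]: "f \<in> borel_measurable borel" "g \<in> borel_measurable borel" "k \<in> borel_measurable borel"
    and bounded: "\<And>x. f x \<le> ennreal c" "\<And>x. g x \<le> ennreal d"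
    and mid: "\<And>x y. f x * g y \<le> (k ((x + y) / 2))\<^sup>2"
  shows "(\<integral>\<^sup>+x. f x \<partial>lborel) * (\<integral>\<^sup>+x. g x \<partial>lborel) \<le> (\<integral>\<^sup>+x. k x \<partial>lborel)\<^sup>2"
proof (cases "(SUP x. f x) = 0 \<or> (SUP x. g x) = 0")
  case True
  then have "(\<forall>x. f x = 0) \<or> (\<forall>x. g x = 0)"
    by (metis SUP_upper UNIV_I le_zero_eq)
  then show ?thesis by auto
next
  case False
  have "(SUP x. f x) \<le> ennreal c" "(SUP x. g x) \<le> ennreal d"
    using bounded by (auto intro: SUP_least)
  then have "(SUP x. f x) \<noteq> top" "(SUP x. g x) \<noteq> top" by (metis ennreal_neq_top top_unique)+
  then obtain a b where ab: "(SUP x. f x) = ennreal a" "(SUP x. g x) = ennreal b" "a \<ge> 0" "b \<ge> 0"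
    by (metis ennreal_cases)
  with False have "a > 0" "b > 0" by (auto simp: less_le)
  note ab = ab(1,2) this
  let ?f = "\<lambda>x. ennreal (1 / a) * f x" and ?g = "\<lambda>x. ennreal (1 / b) * g x"
    and ?k = "\<lambda>x. ennreal (1 / sqrt (a * b)) * k x"
  have sq: "(ennreal (1 / sqrt (a * b)))\<^sup>2 = ennreal (1 / a) * ennreal (1 / b)"
    using ab by (simp add: ennreal_power power_divide flip: ennreal_mult)
  have "(\<integral>\<^sup>+x. ?f x \<partial>lborel) * (\<integral>\<^sup>+x. ?g x \<partial>lborel) \<le> (\<integral>\<^sup>+x. ?k x \<partial>lborel)\<^sup>2"
  proof (rule prekopa_leindler_real_normalized)
    show "(SUP x. ?f x) = 1" "(SUP x. ?g x) = 1"
      using ab by (simp_all add: SUP_mult_left_ennreal[symmetric] flip: ennreal_mult)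
    show "?f x * ?g y \<le> (?k ((x + y) / 2))\<^sup>2" for x y
      unfolding power_mult_distrib sq using mult_left_mono[OF mid[of x y], of "ennreal (1 / a) * ennreal (1 / b)"]
      by (simp add: mult_ac)
  qed measurable
  then have "(ennreal (1 / a) * ennreal (1 / b)) * ((\<integral>\<^sup>+x. f x \<partial>lborel) * (\<integral>\<^sup>+x. g x \<partial>lborel))
      \<le> (ennreal (1 / a) * ennreal (1 / b)) * (\<integral>\<^sup>+x. k x \<partial>lborel)\<^sup>2"
    by (subst (asm) (1 2 3) nn_integral_cmult) (simp_all add: power_mult_distrib sq mult_ac)
  moreover have "ennreal (1 / a) * ennreal (1 / b) \<noteq> 0" "ennreal (1 / a) * ennreal (1 / b) \<noteq> top"
    using ab by (simp_all add: ennreal_mult_eq_top_iff)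
  ultimately show ?thesis using ennreal_mult_le_mult_iff by blast
qed

lemma nn_integral_SUP_truncation:
  assumes [measurable]: "f \<in> borel_measurable M"
  shows "(\<integral>\<^sup>+x. f x \<partial>M) = (SUP n. \<integral>\<^sup>+x. min (f x) (ennreal (real n)) \<partial>M)"
proof -
  have "f x = (SUP n. min (f x) (ennreal (real n)))" for x
  proof (cases "f x")
    case (real r)
    obtain n where "r \<le> real n" using real_arch_simple by blast
    then have "f x = min (f x) (ennreal (real n))" using real by (simp add: min_def ennreal_leI)
    then have "f x \<le> (SUP n. min (f x) (ennreal (real n)))"
      by (intro SUP_upper2[of n]) auto
    then show ?thesis by (intro antisym SUP_least) auto
  next
    case top
    then show ?thesis by (simp add: ennreal_SUP_of_nat_eq_top ennreal_of_nat_eq_real_of_nat[symmetric])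
  qed
  then have "(\<integral>\<^sup>+x. f x \<partial>M) = (\<integral>\<^sup>+x. (SUP n. min (f x) (ennreal (real n))) \<partial>M)" by simp
  also have "\<dots> = (SUP n. \<integral>\<^sup>+x. min (f x) (ennreal (real n)) \<partial>M)"
    by (rule nn_integral_monotone_convergence_SUP)
       (auto simp: incseq_def le_fun_def intro: min.coboundedI2 ennreal_leI)
  finally show ?thesis .
qed

text \<open>Truncating \<open>f\<close> and \<open>g\<close> preserves the hypothesis, and monotone
  convergence removes the truncations.\<close>

lemma prekopa_leindler_real:
  fixes f g k :: "real \<Rightarrow> ennreal"
  assumes [measurable]: "f \<in> borel_measurable borel" "g \<in> borel_measurable borel" "k \<in> borel_measurable borel"
    and mid: "\<And>x y. f x * g y \<le> (k ((x + y) / 2))\<^sup>2"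
  shows "(\<integral>\<^sup>+x. f x \<partial>lborel) * (\<integral>\<^sup>+x. g x \<partial>lborel) \<le> (\<integral>\<^sup>+x. k x \<partial>lborel)\<^sup>2"
proof -
  let ?t = "\<lambda>(f::real\<Rightarrow>ennreal) (n::nat) x. min (f x) (ennreal (real n))"
  have "(\<integral>\<^sup>+x. ?t f n x \<partial>lborel) * (\<integral>\<^sup>+x. ?t g m x \<partial>lborel) \<le> (\<integral>\<^sup>+x. k x \<partial>lborel)\<^sup>2" for n m
  proof (rule prekopa_leindler_real_bounded[where c = n and d = m])
    show "?t f n x * ?t g m y \<le> (k ((x + y) / 2))\<^sup>2" for x y
      using mult_mono[of "?t f n x" "f x" "?t g m y" "g y"] mid[of x y] by auto
  qed auto
  then show ?thesis
    unfolding nn_integral_SUP_truncation[of f lborel, simplified] nn_integral_SUP_truncation[of g lborel, simplified]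
    by (simp add: SUP_mult_right_ennreal SUP_mult_left_ennreal SUP_le_iff)
qed

section \<open>The Prekopa-Leindler inequality in all dimensions\<close>

text \<open>Induction on the coordinates: by the one-dimensional inequality, integrating out the new
  coordinate yields three functions that again satisfy the midpoint hypothesis. The midpoint is
  restricted to \<open>I\<close> because points of the product space are extensional
  functions.\<close>

lemma prekopa_leindler_PiM:
  fixes f g k :: "('i \<Rightarrow> real) \<Rightarrow> ennreal"
  assumes "finite I"
    and "f \<in> borel_measurable (\<Pi>\<^sub>M i\<in>I. lborel)" "g \<in> borel_measurable (\<Pi>\<^sub>M i\<in>I. lborel)"
      "k \<in> borel_measurable (\<Pi>\<^sub>M i\<in>I. lborel)"
    and "\<And>x y. x \<in> space (\<Pi>\<^sub>M i\<in>I. lborel :: real measure) \<Longrightarrow> y \<in> space (\<Pi>\<^sub>M i\<in>I. lborel :: real measure) \<Longrightarrow>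
      f x * g y \<le> (k (\<lambda>i\<in>I. (x i + y i) / 2))\<^sup>2"
  shows "(\<integral>\<^sup>+x. f x \<partial>(\<Pi>\<^sub>M i\<in>I. lborel)) * (\<integral>\<^sup>+x. g x \<partial>(\<Pi>\<^sub>M i\<in>I. lborel))
    \<le> (\<integral>\<^sup>+x. k x \<partial>(\<Pi>\<^sub>M i\<in>I. lborel))\<^sup>2"
  using assms
proof (induction I arbitrary: f g k rule: finite_induct)
  case empty
  interpret product_sigma_finite "\<lambda>_::'i. lborel :: real measure" by standard
  from empty show ?case by (simp add: nn_integral_empty space_PiM restrict_def)
next
  case (insert i I)
  interpret product_sigma_finite "\<lambda>_::'i. lborel :: real measure" by standard
  note [measurable] = insert.prems(1-3)
  have sp: "x(i := s) \<in> space (\<Pi>\<^sub>M i\<in>insert i I. lborel :: real measure)"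
    if "x \<in> space (\<Pi>\<^sub>M i\<in>I. lborel :: real measure)" for x s
    using that by (auto simp: space_PiM PiE_def extensional_def)
  have me: "(\<lambda>s. F (x(i := s))) \<in> borel_measurable borel"
    if "x \<in> space (\<Pi>\<^sub>M i\<in>I. lborel :: real measure)" and [measurable]: "F \<in> borel_measurable (\<Pi>\<^sub>M i\<in>insert i I. lborel :: real measure)"
    for x and F :: "('i \<Rightarrow> real) \<Rightarrow> ennreal"
    using that(1) by measurable
  have upd: "(\<lambda>j\<in>insert i I. ((x(i := s)) j + (y(i := t)) j) / 2) = (\<lambda>j\<in>I. (x j + y j) / 2)(i := (s + t) / 2)"
    for x y :: "'i \<Rightarrow> real" and s t
    using insert.hyps by (auto simp: fun_eq_iff)
  show ?case
    unfolding product_nn_integral_insert[OF insert.hyps insert.prems(1)]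
      product_nn_integral_insert[OF insert.hyps insert.prems(2)]
      product_nn_integral_insert[OF insert.hyps insert.prems(3)]
  proof (rule insert.IH)
    fix x y assume x: "x \<in> space (\<Pi>\<^sub>M i\<in>I. lborel :: real measure)" and y: "y \<in> space (\<Pi>\<^sub>M i\<in>I. lborel :: real measure)"
    let ?z = "\<lambda>j\<in>I. (x j + y j) / 2"
    have z: "?z \<in> space (\<Pi>\<^sub>M i\<in>I. lborel :: real measure)" by (simp add: space_PiM)
    show "(\<integral>\<^sup>+s. f (x(i := s)) \<partial>lborel) * (\<integral>\<^sup>+s. g (y(i := s)) \<partial>lborel) \<le> (\<integral>\<^sup>+s. k (?z(i := s)) \<partial>lborel)\<^sup>2"
    proof (rule prekopa_leindler_real)
      show "f (x(i := s)) * g (y(i := t)) \<le> (k (?z(i := (s + t) / 2)))\<^sup>2" for s t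
        using insert.prems(4)[OF sp[OF x] sp[OF y], of s t] unfolding upd .
    qed (use me x y z insert.prems in auto)
  qed measurable
qed

text \<open>The coordinate map of \<open>Basis\<close> is linear, hence preserves midpoints, and
  carries the product measure to \<open>lborel\<close>.\<close>

theorem prekopa_leindler:
  fixes f g k :: "'a::euclidean_space \<Rightarrow> ennreal"
  assumes [measurable]: "f \<in> borel_measurable borel" "g \<in> borel_measurable borel" "k \<in> borel_measurable borel"
    and mid: "\<And>x y. f x * g y \<le> (k ((1/2) *\<^sub>R (x + y)))\<^sup>2"
  shows "(\<integral>\<^sup>+x. f x \<partial>lborel) * (\<integral>\<^sup>+x. g x \<partial>lborel) \<le> (\<integral>\<^sup>+x. k x \<partial>lborel)\<^sup>2"
proof -
  let ?L = "\<lambda>x. \<Sum>b\<in>Basis. x b *\<^sub>R b :: 'a"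
  have int: "(\<integral>\<^sup>+x. F x \<partial>lborel) = (\<integral>\<^sup>+x. F (?L x) \<partial>(\<Pi>\<^sub>M b\<in>Basis. lborel))"
    if "F \<in> borel_measurable borel" for F :: "'a \<Rightarrow> ennreal"
    by (subst lborel_eq, subst nn_integral_distr) (use that in auto)
  have "?L (\<lambda>b\<in>Basis. (x b + y b) / 2) = (1/2) *\<^sub>R (?L x + ?L y)" for x y
    by (simp add: scaleR_sum_right sum.distrib[symmetric] algebra_simps add_divide_distrib)
  then show ?thesis
    unfolding int[OF assms(1)] int[OF assms(2)] int[OF assms(3)]
    by (intro prekopa_leindler_PiM) (use mid in auto)
qed

section \<open>The second variation argument\<close>

text \<open>Log-concavity is stated for midpoints and with a square, which avoids roots and admits
  the value 0 outside the domain of the convex potential. Finiteness is asked on balls only, because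
  removing the radial weight from a finite measure can leave an infinite one.\<close>

locale even_log_concave =
  fixes E :: "'a::euclidean_space \<Rightarrow> ennreal" and \<mu> :: "'a measure"
  assumes density_measurable [measurable]: "E \<in> borel_measurable borel"
    and log_concave: "\<And>x y. E x * E y \<le> (E ((1/2) *\<^sub>R (x + y)))\<^sup>2"
    and density_eq: "\<mu> = density lborel E"
    and even: "\<And>A. A \<in> sets borel \<Longrightarrow> emeasure \<mu> (uminus -` A) = emeasure \<mu> A"
    and finite_cball: "\<And>r. emeasure \<mu> (cball 0 r) < \<infinity>"
begin

lemma sets_eq [simp, measurable_cong]: "sets \<mu> = sets borel"
  by (simp add: density_eq)

lemma space_eq [simp]: "space \<mu> = UNIV"
  by (simp add: density_eq)

sublocale sigma_finite_measure \<mu>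
proof
  have "(\<Union>n. cball (0::'a) (real n)) = UNIV" using real_arch_simple by auto
  then show "\<exists>A. countable A \<and> A \<subseteq> sets \<mu> \<and> \<Union> A = space \<mu> \<and> (\<forall>a\<in>A. emeasure \<mu> a \<noteq> \<infinity>)"
    using finite_cball by (intro exI[of _ "range (\<lambda>n. cball 0 (real n))"]) (auto simp: less_top)
qed

text \<open>Prekopa-Leindler for \<open>E\<close> restricted to \<open>A\<close>, to its reflection
  and to \<open>B\<close> bounds the product of the measures of \<open>A\<close> and its reflection
  by the squared measure of \<open>B\<close>. By evenness the two factors agree.\<close>

lemma emeasure_le_of_midpoint:
  assumes A: "A \<in> sets borel" and B: "B \<in> sets borel"
    and mid: "\<And>x y. x \<in> A \<Longrightarrow> y \<in> A \<Longrightarrow> (1/2) *\<^sub>R (x - y) \<in> B"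
  shows "emeasure \<mu> A \<le> emeasure \<mu> B"
proof (rule ccontr)
  assume *: "\<not> emeasure \<mu> A \<le> emeasure \<mu> B"
  have A': "uminus -` A \<in> sets borel"
    using measurable_sets[of uminus borel borel A] A by simp
  have em: "emeasure \<mu> S = (\<integral>\<^sup>+x. E x * indicator S x \<partial>lborel)" if "S \<in> sets borel" for S
    using that by (simp add: density_eq emeasure_density)
  have "emeasure \<mu> A * emeasure \<mu> (uminus -` A) \<le> (emeasure \<mu> B)\<^sup>2"
    unfolding em[OF A] em[OF A'] em[OF B]
  proof (rule prekopa_leindler)
    show "E x * indicator A x * (E y * indicator (uminus -` A) y)
        \<le> (E ((1/2) *\<^sub>R (x + y)) * indicator B ((1/2) *\<^sub>R (x + y)))\<^sup>2" for x y
      using mid[of x "- y"] log_concave[of x y] by (auto simp: indicator_def)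
  qed (use A A' B in measurable)
  then have "emeasure \<mu> A * emeasure \<mu> A \<le> (emeasure \<mu> B)\<^sup>2" using even[OF A] by simp
  from ennreal_less_of_mult_le_square[OF _ _ this, of "emeasure \<mu> B"] * show False
    by (simp add: not_le)
qed

text \<open>The functional form of the set comparison: the hypothesis says that each superlevel set
  of \<open>F\<close>, paired with that of \<open>G\<close> at the same level, satisfies the
  midpoint condition.\<close>

lemma nn_integral_le_of_midpoint:
  assumes [measurable]: "F \<in> borel_measurable borel" "G \<in> borel_measurable borel"
    and mid: "\<And>x y. min (F x) (F y) \<le> G ((1/2) *\<^sub>R (x - y))"
  shows "(\<integral>\<^sup>+x. F x \<partial>\<mu>) \<le> (\<integral>\<^sup>+x. G x \<partial>\<mu>)"
proof -
  have "emeasure \<mu> {x. ennreal t < F x} \<le> emeasure \<mu> {x. ennreal t < G x}" for t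
  proof (rule emeasure_le_of_midpoint)
    show "(1/2) *\<^sub>R (x - y) \<in> {x. ennreal t < G x}"
      if "x \<in> {x. ennreal t < F x}" "y \<in> {x. ennreal t < F x}" for x y
      using that less_le_trans[OF _ mid[of x y], of "ennreal t"] by simp
  qed simp_all
  then show ?thesis
    by (subst (1 2) nn_integral_layer_cake) (auto intro!: nn_integral_mono mult_left_mono)
qed

end

section \<open>Pointwise estimates for the perturbed squared norm\<close>

lemma gradient_even:
  fixes h :: "'a::euclidean_space \<Rightarrow> real"
  assumes grad: "\<And>x. GDERIV h x :> grad_h x" and odd: "\<And>x. h (- x) = - h x"
  shows "grad_h (- x) = grad_h x"
proof -
  have "((\<lambda>y. h (- y)) has_derivative (\<lambda>d. (- d) \<bullet> grad_h (- x))) (at x)"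
    by (rule has_derivative_compose[of uminus _ _ _ h, OF _ grad[unfolded gderiv_def]])
       (auto intro!: derivative_eq_intros)
  then have "((\<lambda>y. - h y) has_derivative (\<lambda>d. (- d) \<bullet> grad_h (- x))) (at x)"
    by (simp only: odd)
  moreover have "((\<lambda>y. - h y) has_derivative (\<lambda>d. - (d \<bullet> grad_h x))) (at x)"
    using grad[unfolded gderiv_def] by (rule has_derivative_minus)
  ultimately have "(\<lambda>d. (- d) \<bullet> grad_h (- x)) = (\<lambda>d. - (d \<bullet> grad_h x))"
    by (rule has_derivative_unique)
  then have "d \<bullet> (grad_h (- x) - grad_h x) = 0" for d
    by (simp add: fun_eq_iff inner_diff_right)
  then show ?thesis using inner_eq_zero_iff right_minus_eq by blast
qed

lemma gradient_mvt:
  fixes h :: "'a::real_inner \<Rightarrow> real"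
  assumes grad: "\<And>x. GDERIV h x :> grad_h x"
  obtains z where "z \<in> closed_segment y x" "h x - h y = (x - y) \<bullet> grad_h z"
proof -
  let ?p = "\<lambda>t. y + t *\<^sub>R (x - y)"
  have "((\<lambda>t. h (?p t)) has_real_derivative (x - y) \<bullet> grad_h (?p t)) (at t)" for t
  proof -
    have "((\<lambda>t. h (?p t)) has_derivative (\<lambda>s. (s *\<^sub>R (x - y)) \<bullet> grad_h (?p t))) (at t)"
      by (rule has_derivative_compose[of ?p _ _ _ h, OF _ grad[unfolded gderiv_def]])
         (auto intro!: derivative_eq_intros)
    then show ?thesis by (simp add: has_field_derivative_def mult.commute[of _ "(x - y) \<bullet> _"])
  qed
  then have "\<exists>t>0. t < 1 \<and> h (?p 1) - h (?p 0) = (1 - 0) * ((x - y) \<bullet> grad_h (?p t))"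
    by (intro MVT2) auto
  then obtain t where t: "0 < t" "t < 1" "h x - h y = (x - y) \<bullet> grad_h (?p t)" by auto
  moreover have "?p t \<in> closed_segment y x"
    using t by (auto simp: closed_segment_def algebra_simps intro!: exI[of _ t])
  ultimately show ?thesis using that by blast
qed

text \<open>By the parallelogram law the claim reduces to bounding
  \<open>4 * \<epsilon> * (h x + h y)\<close> by \<open>(norm (x + y))\<^sup>2\<close> plus second
  order terms. Oddness turns \<open>h x + h y\<close> into the increment of \<open>h\<close> from
  \<open>- y\<close> to \<open>x\<close>. The slack \<open>\<eta>\<close> absorbs the variation of
  the squared gradient norm, so the inequality is exact on the ball for all small
  \<open>\<epsilon>\<close>.\<close>

lemma perturbed_norm_midpoint:
  fixes h :: "'a::euclidean_space \<Rightarrow> real"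
  assumes grad: "\<And>x. GDERIV h x :> grad_h x" and cont: "continuous_on UNIV grad_h"
    and odd: "\<And>x. h (- x) = - h x" and \<eta>: "\<eta> > 0"
  defines "q \<equiv> \<lambda>\<epsilon> x. (norm x)\<^sup>2 - 2 * \<epsilon> * h x + \<epsilon>\<^sup>2 * ((norm (grad_h x))\<^sup>2 + \<eta>)"
  shows "\<exists>\<epsilon>0>0. \<forall>\<epsilon> x y. 0 < \<epsilon> \<longrightarrow> \<epsilon> < \<epsilon>0 \<longrightarrow> x \<in> cball 0 R \<longrightarrow> y \<in> cball 0 R \<longrightarrow>
    (norm ((1/2) *\<^sub>R (x - y)))\<^sup>2 \<le> (q \<epsilon> x + q \<epsilon> y) / 2"
proof -
  let ?g = "\<lambda>x. (norm (grad_h x))\<^sup>2"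
  have "bounded (grad_h ` cball 0 R)"
    by (intro compact_imp_bounded compact_continuous_image continuous_on_subset[OF cont]) auto
  then obtain C where C: "C > 0" "\<And>x. x \<in> cball 0 R \<Longrightarrow> norm (grad_h x) \<le> C"
    unfolding bounded_pos by auto
  have "uniformly_continuous_on (cball 0 R) ?g"
    by (intro compact_uniformly_continuous continuous_intros continuous_on_subset[OF cont]) auto
  then obtain \<delta> where \<delta>: "\<delta> > 0"
      "\<And>x y. x \<in> cball 0 R \<Longrightarrow> y \<in> cball 0 R \<Longrightarrow> dist y x < \<delta> \<Longrightarrow> dist (?g y) (?g x) < \<eta>"
    using \<eta> unfolding uniformly_continuous_on_def by meson
  show ?thesis
  \<comment> \<open>This choice gives \<open>4 * C * \<epsilon> < \<delta>\<close>: when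
    \<open>norm (x + y)\<close> is at least \<open>\<delta>\<close>, the linear term is already
    dominated by \<open>(norm (x + y))\<^sup>2\<close>.\<close>
  proof (intro exI[of _ "\<delta> / (4 * C)"] conjI allI impI)
    show "0 < \<delta> / (4 * C)" using \<delta> C by simp
    fix \<epsilon> :: real and x y :: 'a
    assume \<epsilon>: "0 < \<epsilon>" "\<epsilon> < \<delta> / (4 * C)" and x: "x \<in> cball 0 R" and y: "y \<in> cball 0 R"
    have y': "- y \<in> cball 0 R" using y by simp
    obtain z where z: "z \<in> closed_segment (- y) x" "h x - h (- y) = (x - (- y)) \<bullet> grad_h z"
      using gradient_mvt[OF grad] .
    have zB: "z \<in> cball 0 R"
      using z(1) x y' closed_segment_subset[OF y' x convex_cball] by auto
    have hz: "h x + h y \<le> norm (x + y) * norm (grad_h z)"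
      using z(2) odd[of y] norm_cauchy_schwarz[of "x + y" "grad_h z"] by simp
    have key: "4 * \<epsilon> * (h x + h y) - (norm (x + y))\<^sup>2 \<le> 2 * \<epsilon>\<^sup>2 * (?g x + ?g y) + 4 * \<epsilon>\<^sup>2 * \<eta>"
    proof (cases "norm (x + y) < \<delta>")
      case True
      \<comment> \<open>The mean value point \<open>z\<close> is close to both \<open>x\<close> and
        \<open>- y\<close>. Evenness of the gradient replaces \<open>- y\<close> by
        \<open>y\<close>, and averaging the two bounds makes the estimate symmetric.\<close>
      have "dist z x \<le> norm (x + y)" "dist z (- y) \<le> norm (x + y)"
        using z(1) segment_bound[of z "- y" x] by (simp_all add: dist_norm norm_minus_commute add.commute)
      then have "?g z \<le> ?g x + \<eta>" "?g z \<le> ?g y + \<eta>"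
        unfolding gradient_even[OF grad odd, of y, symmetric] using \<delta>(2)[OF x zB] \<delta>(2)[OF y' zB] True by (auto simp: dist_real_def abs_less_iff)
      then have gz: "?g z \<le> (?g x + ?g y) / 2 + \<eta>"
      proof -
        have "c \<le> (a + b) / 2 + e" if "c \<le> a + e" "c \<le> b + e" for a b c e :: real
          using that by (simp add: field_simps)
        then show ?thesis using \<open>?g z \<le> ?g x + \<eta>\<close> \<open>?g z \<le> ?g y + \<eta>\<close> by blast
      qed
      have "4 * \<epsilon> * (h x + h y) - (norm (x + y))\<^sup>2 \<le> 4 * \<epsilon> * (norm (x + y) * norm (grad_h z)) - (norm (x + y))\<^sup>2"
        using hz \<epsilon> by simp
      also have "\<dots> \<le> 4 * \<epsilon>\<^sup>2 * ?g z"
        using zero_le_power2[of "norm (x + y) - 2 * \<epsilon> * norm (grad_h z)"]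
        by (simp add: power2_eq_square algebra_simps)
      also have "\<dots> \<le> 4 * \<epsilon>\<^sup>2 * ((?g x + ?g y) / 2 + \<eta>)"
        using gz by (intro mult_left_mono) auto
      finally show ?thesis by (simp add: field_simps)
    next
      case False
      have "4 * \<epsilon> * (h x + h y) \<le> 4 * \<epsilon> * (norm (x + y) * C)"
      proof (intro mult_left_mono)
        show "h x + h y \<le> norm (x + y) * C"
          using hz mult_left_mono[OF C(2)[OF zB] norm_ge_zero[of "x + y"]] by linarith
      qed (use \<epsilon> in simp)
      also have "\<dots> = (4 * C * \<epsilon>) * norm (x + y)" by simp
      also have "\<dots> \<le> norm (x + y) * norm (x + y)"
        using \<epsilon> C False by (intro mult_right_mono) (auto simp: field_simps)
      finally have "4 * \<epsilon> * (h x + h y) - (norm (x + y))\<^sup>2 \<le> 0" by (simp add: power2_eq_square)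
      also have "0 \<le> 2 * \<epsilon>\<^sup>2 * (?g x + ?g y) + 4 * \<epsilon>\<^sup>2 * \<eta>" using \<eta> by simp
      finally show ?thesis .
    qed
    have "(norm ((1/2) *\<^sub>R (x - y)))\<^sup>2 = ((norm x)\<^sup>2 + (norm y)\<^sup>2) / 2 - (norm (x + y))\<^sup>2 / 4"
      by (simp add: power2_norm_eq_inner inner_simps inner_commute field_simps power_divide)
    then show "(norm ((1/2) *\<^sub>R (x - y)))\<^sup>2 \<le> (q \<epsilon> x + q \<epsilon> y) / 2"
      using key unfolding q_def by (simp add: field_simps)
  qed
qed

text \<open>Lagrange's remainder for \<Phi>' = -\<phi> and \<Phi>'' = \<psi>. With these signs, a
  decreasing convex \<open>\<Phi>\<close> has nonnegative \<open>\<phi>\<close> and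
  \<open>\<psi>\<close>.\<close>

lemma taylor_second_order:
  fixes \<Phi> \<phi> \<psi> :: "real \<Rightarrow> real"
  assumes d1: "\<And>s. (\<Phi> has_real_derivative - \<phi> s) (at s)" and d2: "\<And>s. (\<phi> has_real_derivative - \<psi> s) (at s)"
  obtains \<xi> where "\<bar>\<xi> - s\<bar> \<le> \<bar>u\<bar>" "\<Phi> (s + u) = \<Phi> s - \<phi> s * u + \<psi> \<xi> / 2 * u\<^sup>2"
proof (cases "u = 0")
  case True
  then show ?thesis using that[of s] by simp
next
  case False
  define D where "D = (\<lambda>m::nat. if m = 0 then \<Phi> else if m = 1 then (\<lambda>s. - \<phi> s) else \<psi>)"
  have "\<exists>t. (if s + u < s then s + u < t \<and> t < s else s < t \<and> t < s + u) \<and>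
      \<Phi> (s + u) = (\<Sum>m<2. D m s / fact m * (s + u - s) ^ m) + D 2 t / fact 2 * (s + u - s)\<^sup>2"
  proof (rule Taylor[of 2 D \<Phi> "min s (s + u)" "max s (s + u)"])
    show "\<forall>m t. m < 2 \<and> min s (s + u) \<le> t \<and> t \<le> max s (s + u) \<longrightarrow>
        (D m has_real_derivative D (Suc m) t) (at t)"
      using d1 DERIV_minus[OF d2] by (auto simp: D_def less_2_cases_iff)
  qed (use False in \<open>auto simp: D_def\<close>)
  then obtain t where t: "if s + u < s then s + u < t \<and> t < s else s < t \<and> t < s + u"
      "\<Phi> (s + u) = \<Phi> s - \<phi> s * u + \<psi> t / 2 * u\<^sup>2"
    by (auto simp: D_def lessThan_Suc numeral_2_eq_2 algebra_simps)
  then show ?thesis by (intro that[of t]) (auto split: if_splits)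
qed

text \<open>The increment of the squared norm is \<open>\<epsilon> * v\<close> with
  \<open>v = - 2 * h x + \<epsilon> * g x\<close>, so the quadratic Taylor term is close to
  \<open>2 * \<epsilon>\<^sup>2 * \<psi> * h\<^sup>2\<close>. Compactness makes the error at most
  \<open>\<omega> * \<epsilon>\<^sup>2\<close>, uniformly on the ball.\<close>

lemma taylor_perturbed_norm:
  fixes h g :: "'a::euclidean_space \<Rightarrow> real" and \<Phi> \<phi> \<psi> :: "real \<Rightarrow> real"
  assumes d1: "\<And>s. (\<Phi> has_real_derivative - \<phi> s) (at s)" and d2: "\<And>s. (\<phi> has_real_derivative - \<psi> s) (at s)"
    and cont: "continuous_on UNIV \<psi>" and nonneg: "\<And>s. \<psi> s \<ge> 0"
    and h: "\<And>x. x \<in> cball 0 R \<Longrightarrow> \<bar>h x\<bar> \<le> C" and g: "\<And>x. x \<in> cball 0 R \<Longrightarrow> \<bar>g x\<bar> \<le> C" and \<omega>: "\<omega> > 0"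
  defines "q \<equiv> \<lambda>\<epsilon> x. (norm x)\<^sup>2 - 2 * \<epsilon> * h x + \<epsilon>\<^sup>2 * g x"
  shows "\<exists>\<epsilon>0>0. \<forall>\<epsilon> x. 0 < \<epsilon> \<longrightarrow> \<epsilon> < \<epsilon>0 \<longrightarrow> x \<in> cball 0 R \<longrightarrow>
    \<Phi> ((norm x)\<^sup>2) + 2 * \<epsilon> * (\<phi> ((norm x)\<^sup>2) * h x)
      + \<epsilon>\<^sup>2 * (2 * (\<psi> ((norm x)\<^sup>2) * (h x)\<^sup>2) - \<phi> ((norm x)\<^sup>2) * g x - \<omega>) \<le> \<Phi> (q \<epsilon> x)"
proof -
  \<comment> \<open>The margin 1 leaves room for the perturbed squared norm and the Taylor
    point.\<close>
  define K where "K = {-1..R\<^sup>2 + 1}"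
  have cpt: "compact K" by (simp add: K_def)
  have "bounded (\<psi> ` K)"
    by (intro compact_imp_bounded compact_continuous_image continuous_on_subset[OF cont]) (auto simp: cpt)
  then obtain D where D: "D > 0" "\<And>s. s \<in> K \<Longrightarrow> \<psi> s \<le> D"
    unfolding bounded_pos by fastforce
  define C' where "C' = \<bar>C\<bar> + 1"
  have C': "C' \<ge> 1" "\<And>x. x \<in> cball 0 R \<Longrightarrow> \<bar>h x\<bar> \<le> C'" "\<And>x. x \<in> cball 0 R \<Longrightarrow> \<bar>g x\<bar> \<le> C'"
    using h g unfolding C'_def by force+
  \<comment> \<open>Since \<open>v\<^sup>2\<close> will be at most \<open>9 * C'\<^sup>2\<close>,
    replacing \<open>\<psi> \<xi>\<close> by \<open>\<psi> s\<close> costs at most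
    \<open>\<omega>\<close>.\<close>
  define \<omega>' where "\<omega>' = \<omega> / (9 * C'\<^sup>2)"
  have \<omega>': "\<omega>' > 0" using \<omega> C' by (simp add: \<omega>'_def)
  have "uniformly_continuous_on K \<psi>"
    by (intro compact_uniformly_continuous continuous_on_subset[OF cont]) (auto simp: cpt)
  then obtain \<delta> where \<delta>: "\<delta> > 0"
      "\<And>s t. s \<in> K \<Longrightarrow> t \<in> K \<Longrightarrow> dist t s < \<delta> \<Longrightarrow> dist (\<psi> t) (\<psi> s) < \<omega>'"
    using \<omega>' unfolding uniformly_continuous_on_def by meson
  \<comment> \<open>In order, the four bounds ensure that \<open>\<bar>v\<bar> \<le> 3 * C'\<close>,
    that the Taylor point stays in \<open>K\<close>, that it is within \<open>\<delta>\<close> of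
    \<open>s\<close>, and that the cross term of \<open>v\<^sup>2\<close> costs at most
    \<open>\<omega>\<close>.\<close>
  define \<epsilon>0 where "\<epsilon>0 = Min {1, 1 / (3 * C'), \<delta> / (3 * C'), \<omega> / (4 * D * C'\<^sup>2)}"
  have \<epsilon>0: "\<epsilon>0 > 0" using \<delta> C' \<omega> D by (auto simp: \<epsilon>0_def)
  show ?thesis
  proof (intro exI[of _ \<epsilon>0] conjI allI impI \<epsilon>0)
    fix \<epsilon> :: real and x :: 'a
    assume \<epsilon>: "0 < \<epsilon>" "\<epsilon> < \<epsilon>0" and x: "x \<in> cball 0 R"
    have eps: "\<epsilon> \<le> 1" "\<epsilon> * (3 * C') < 1" "\<epsilon> * (3 * C') < \<delta>" "\<epsilon> * (4 * D * C'\<^sup>2) < \<omega>"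
      using \<epsilon> C' D by (auto simp: \<epsilon>0_def pos_less_divide_eq)
    define s where "s = (norm x)\<^sup>2"
    define v where "v = - 2 * h x + \<epsilon> * g x"
    have "\<bar>\<epsilon> * g x\<bar> \<le> 1 * C'"
      unfolding abs_mult using eps \<epsilon> C'(3)[OF x] by (intro mult_mono) auto
    then have v: "\<bar>v\<bar> \<le> 3 * C'" using C'(2)[OF x] unfolding v_def by linarith
    have qv: "q \<epsilon> x = s + \<epsilon> * v" by (simp add: q_def s_def v_def power2_eq_square algebra_simps)
    have ev: "\<bar>\<epsilon> * v\<bar> \<le> \<epsilon> * (3 * C')" using v \<epsilon> by (simp add: abs_mult)
    have s: "0 \<le> s" "s \<le> R\<^sup>2" using x by (auto simp: s_def intro!: power_mono)
    obtain \<xi> where \<xi>: "\<bar>\<xi> - s\<bar> \<le> \<bar>\<epsilon> * v\<bar>" "\<Phi> (s + \<epsilon> * v) = \<Phi> s - \<phi> s * (\<epsilon> * v) + \<psi> \<xi> / 2 * (\<epsilon> * v)\<^sup>2"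
      by (rule taylor_second_order[OF d1 d2])
    have K: "s \<in> K" "\<xi> \<in> K" using \<xi>(1) ev eps s by (auto simp: K_def abs_le_iff)
    have "dist (\<psi> \<xi>) (\<psi> s) < \<omega>'" by (rule \<delta>(2)) (use K \<xi>(1) ev eps in \<open>auto simp: dist_real_def\<close>)
    then have \<psi>: "\<psi> s - \<omega>' \<le> \<psi> \<xi>" by (auto simp: dist_real_def)
    have v2: "v\<^sup>2 \<le> 9 * C'\<^sup>2" using power_mono[OF v, of 2] by (simp add: power_mult_distrib)
    have "4 * (h x)\<^sup>2 - 4 * \<epsilon> * C'\<^sup>2 \<le> v\<^sup>2"
    proof -
      have "h x * g x \<le> C' * C'"
      proof -
        have "\<bar>h x * g x\<bar> \<le> C' * C'"
          unfolding abs_mult using C'(1) C'(2,3)[OF x] by (intro mult_mono) auto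
        then show ?thesis by linarith
      qed
      then have "\<epsilon> * (h x * g x) \<le> \<epsilon> * C'\<^sup>2" using \<epsilon> by (simp add: power2_eq_square)
      moreover have "v\<^sup>2 = 4 * (h x)\<^sup>2 - 4 * (\<epsilon> * (h x * g x)) + (\<epsilon> * g x)\<^sup>2"
        by (simp add: v_def power2_eq_square algebra_simps)
      ultimately show ?thesis using zero_le_power2[of "\<epsilon> * g x"] by linarith
    qed
    then have "\<psi> s * (4 * (h x)\<^sup>2 - 4 * \<epsilon> * C'\<^sup>2) \<le> \<psi> s * v\<^sup>2"
      using nonneg by (intro mult_left_mono)
    moreover have "\<psi> s * (4 * \<epsilon> * C'\<^sup>2) \<le> D * (4 * \<epsilon> * C'\<^sup>2)"
      using D(2)[OF K(1)] \<epsilon> by (intro mult_right_mono) auto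
    moreover have "D * (4 * \<epsilon> * C'\<^sup>2) \<le> \<omega>" using eps(4) by (simp add: mult_ac)
    moreover have "\<omega>' * v\<^sup>2 \<le> \<omega>"
      using mult_left_mono[OF v2, of \<omega>'] \<omega>' C' by (simp add: \<omega>'_def)
    moreover have "(\<psi> s - \<omega>') * v\<^sup>2 \<le> \<psi> \<xi> * v\<^sup>2" using \<psi> by (intro mult_right_mono) auto
    \<comment> \<open>The two errors add up to \<open>2 * \<omega>\<close>; the factor 1/2 of the
      Taylor term leaves \<open>\<omega>\<close>.\<close>
    ultimately have "4 * (\<psi> s * (h x)\<^sup>2) - 2 * \<omega> \<le> \<psi> \<xi> * v\<^sup>2" by (simp add: algebra_simps)
    then have "\<epsilon>\<^sup>2 * (2 * (\<psi> s * (h x)\<^sup>2) - \<omega>) \<le> \<epsilon>\<^sup>2 * (\<psi> \<xi> / 2 * v\<^sup>2)"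
      by (intro mult_left_mono) auto
    moreover have "\<Phi> s - \<phi> s * (\<epsilon> * v) = \<Phi> s + 2 * \<epsilon> * (\<phi> s * h x) - \<epsilon>\<^sup>2 * (\<phi> s * g x)"
      by (simp add: v_def power2_eq_square algebra_simps)
    ultimately show "\<Phi> ((norm x)\<^sup>2) + 2 * \<epsilon> * (\<phi> ((norm x)\<^sup>2) * h x)
      + \<epsilon>\<^sup>2 * (2 * (\<psi> ((norm x)\<^sup>2) * (h x)\<^sup>2) - \<phi> ((norm x)\<^sup>2) * g x - \<omega>) \<le> \<Phi> (q \<epsilon> x)"
      unfolding qv \<xi>(2) s_def[symmetric] by (simp add: algebra_simps power_mult_distrib)
  qed
qed

text \<open>\<open>F s\<close> is the integral of \<open>f\<close> from \<open>s\<close> to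
  \<open>\<beta>\<close>. The lemma recovers \<open>\<phi>\<close> from \<open>\<psi>\<close> and
  \<open>\<Phi>\<close> from \<open>\<phi>\<close>, all vanishing beyond the same point.\<close>

lemma antiderivative_vanishing:
  fixes f :: "real \<Rightarrow> real"
  assumes cont: "continuous_on UNIV f" and zero: "\<And>s. \<beta> \<le> s \<Longrightarrow> f s = 0"
  obtains F where "\<And>s. (F has_real_derivative - f s) (at s)" "\<And>s. \<beta> \<le> s \<Longrightarrow> F s = 0"
proof -
  have "isCont f s" for s using cont by (simp add: continuous_on_eq_continuous_at)
  then obtain F' where F': "\<And>s. (F' has_real_derivative - f s) (at s)"
    using einterval_antiderivative[of "-\<infinity>" "\<infinity>" "\<lambda>s. - f s"]
    by (auto simp: has_real_derivative_iff_has_vector_derivative)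
  have "F' s - F' \<beta> = 0" if "\<beta> \<le> s" for s
  proof (cases "s = \<beta>")
    case False
    with that have "\<beta> < s" by simp
    then obtain z where "\<beta> < z" "F' s - F' \<beta> = (s - \<beta>) * - f z"
      using MVT2[of \<beta> s F' "\<lambda>s. - f s"] F' by blast
    then show ?thesis using zero by simp
  qed simp
  moreover have "((\<lambda>s. F' s - F' \<beta>) has_real_derivative - f s) (at s)" for s
    using DERIV_diff[OF F' DERIV_const] by simp
  ultimately show ?thesis using that by blast
qed

lemma antiderivative_nonneg:
  fixes f F :: "real \<Rightarrow> real"
  assumes deriv: "\<And>s. (F has_real_derivative - f s) (at s)" and nonneg: "\<And>s. f s \<ge> 0"
    and zero: "\<And>s. \<beta> \<le> s \<Longrightarrow> F s = 0"
  shows "F s \<ge> 0"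
proof -
  have "F (max s \<beta>) \<le> F s"
    by (rule DERIV_nonpos_imp_nonincreasing[of s]) (use deriv nonneg in force)+
  then show ?thesis using zero[of "max s \<beta>"] by simp
qed

section \<open>Restriction to balls and the inequality for compactly supported radial
  weights\<close>

context even_log_concave
begin

text \<open>On a closed ball the measure is finite and continuous functions are integrable, so
  signed integrands such as the first order term can be expanded by linearity.\<close>

definition ball_measure :: "real \<Rightarrow> 'a measure" where
  "ball_measure r = density \<mu> (indicator (cball 0 r))"

lemma ball_measure_sets [simp, measurable_cong]: "sets (ball_measure r) = sets borel"
  by (simp add: ball_measure_def)

lemma ball_measure_space [simp]: "space (ball_measure r) = UNIV"
  by (simp add: ball_measure_def)

lemma indicator_cball_measurable [measurable]: "indicator (cball 0 r) \<in> borel_measurable \<mu>"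
  by (intro borel_measurable_indicator) simp

lemma emeasure_ball_measure:
  "A \<in> sets borel \<Longrightarrow> emeasure (ball_measure r) A = emeasure \<mu> (cball 0 r \<inter> A)"
proof -
  assume A: "A \<in> sets borel"
  then have "emeasure (ball_measure r) A = (\<integral>\<^sup>+x. indicator (cball 0 r) x * indicator A x \<partial>\<mu>)"
    unfolding ball_measure_def by (intro emeasure_density) auto
  also have "\<dots> = (\<integral>\<^sup>+x. indicator (cball 0 r \<inter> A) x \<partial>\<mu>)"
    by (intro nn_integral_cong) (auto simp: indicator_def)
  finally show ?thesis using A by simp
qed

lemma finite_ball_measure: "finite_measure (ball_measure r)"
  by standard (use finite_cball[of r] emeasure_ball_measure[of UNIV r] in \<open>simp add: less_top\<close>)

lemma AE_ball_measure: "AE x in ball_measure r. x \<in> cball 0 r"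
  unfolding ball_measure_def by (subst AE_density) (auto simp: indicator_def)

lemma nn_integral_ball_measure:
  assumes "f \<in> borel_measurable borel"
  shows "(\<integral>\<^sup>+x. f x \<partial>ball_measure r) = (\<integral>\<^sup>+x. f x * indicator (cball 0 r) x \<partial>\<mu>)"
  unfolding ball_measure_def by (subst nn_integral_density) (use assms in \<open>auto simp: mult.commute\<close>)

lemma integrable_ball_measure:
  fixes f :: "'a \<Rightarrow> real"
  assumes "continuous_on UNIV f"
  shows "integrable (ball_measure r) f"
proof -
  interpret finite_measure "ball_measure r" by (rule finite_ball_measure)
  have "bounded (f ` cball 0 r)"
    by (intro compact_imp_bounded compact_continuous_image continuous_on_subset[OF assms]) auto
  then obtain C where "\<And>x. x \<in> cball 0 r \<Longrightarrow> norm (f x) \<le> C"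
    unfolding bounded_iff by (metis imageI)
  then have bound: "AE x in ball_measure r. norm (f x) \<le> C"
    by (intro eventually_mono[OF AE_ball_measure])
  have [measurable]: "f \<in> borel_measurable borel"
    using assms by (rule borel_measurable_continuous_onI)
  from bound show ?thesis by (rule integrable_const_bound) measurable
qed

text \<open>A centred ball is symmetric, so the restricted measure is still invariant under
  reflection. This removes the first order term in \<open>\<epsilon>\<close>.\<close>

lemma integral_odd_ball_measure:
  fixes f :: "'a \<Rightarrow> real"
  assumes [measurable]: "f \<in> borel_measurable borel" and odd: "\<And>x. f (- x) = - f x"
  shows "(\<integral>x. f x \<partial>ball_measure r) = 0"
proof -
  have "emeasure (ball_measure r) (uminus -` A) = emeasure (ball_measure r) A" if A: "A \<in> sets borel" for A
  proof -
    have "uminus -` A \<in> sets borel"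
      using measurable_sets[of uminus borel borel A] A by simp
    moreover have "cball 0 r \<inter> uminus -` A = uminus -` (cball (0::'a) r \<inter> A)" by auto
    ultimately show ?thesis using A even[of "cball 0 r \<inter> A"] by (simp add: emeasure_ball_measure del: vimage_Int)
  qed
  then have "distr (ball_measure r) borel uminus = ball_measure r"
    by (intro measure_eqI) (simp_all add: emeasure_distr)
  then have "(\<integral>x. f x \<partial>ball_measure r) = (\<integral>x. f x \<partial>distr (ball_measure r) borel uminus)" by simp
  also have "\<dots> = (\<integral>x. f (- x) \<partial>ball_measure r)" by (rule integral_distr) auto
  finally show ?thesis by (simp add: odd)
qed

text \<open>Multiplying \<open>f\<close> by the indicator of the ball makes the midpoint condition
  global, because the minimum is 0 as soon as one point lies outside. As \<open>g\<close> vanishes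
  off the ball, its integral over the ball is its full integral.\<close>

lemma integral_mono_of_midpoint:
  fixes f g :: "'a \<Rightarrow> real"
  assumes f: "continuous_on UNIV f" "\<And>x. f x \<ge> 0" and g: "continuous_on UNIV g" "\<And>x. g x \<ge> 0"
    and zero: "\<And>x. x \<notin> cball 0 r \<Longrightarrow> g x = 0"
    and mid: "\<And>x y. x \<in> cball 0 r \<Longrightarrow> y \<in> cball 0 r \<Longrightarrow> min (f x) (f y) \<le> g ((1/2) *\<^sub>R (x - y))"
  shows "(\<integral>x. f x \<partial>ball_measure r) \<le> (\<integral>x. g x \<partial>ball_measure r)"
proof -
  have [measurable]: "f \<in> borel_measurable borel" "g \<in> borel_measurable borel"
    using f g by (auto intro: borel_measurable_continuous_onI)
  have "(\<integral>\<^sup>+x. ennreal (f x) * indicator (cball 0 r) x \<partial>\<mu>) \<le> (\<integral>\<^sup>+x. ennreal (g x) \<partial>\<mu>)"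
  proof (rule nn_integral_le_of_midpoint)
    fix x y
    show "min (ennreal (f x) * indicator (cball 0 r) x) (ennreal (f y) * indicator (cball 0 r) y)
        \<le> ennreal (g ((1/2) *\<^sub>R (x - y)))"
    proof (cases "x \<in> cball 0 r \<and> y \<in> cball 0 r")
      case True
      then have "min (f x) (f y) \<le> g ((1/2) *\<^sub>R (x - y))" using mid by blast
      then have "ennreal (f x) \<le> ennreal (g ((1/2) *\<^sub>R (x - y))) \<or> ennreal (f y) \<le> ennreal (g ((1/2) *\<^sub>R (x - y)))"
        by (auto simp: min_le_iff_disj intro: ennreal_leI)
      then show ?thesis using True by (auto simp: min_le_iff_disj)
    qed (auto simp: indicator_def)
  qed (auto intro!: borel_measurable_times_ennreal borel_measurable_indicator)
  also have "(\<integral>\<^sup>+x. ennreal (g x) \<partial>\<mu>) = (\<integral>\<^sup>+x. ennreal (g x) * indicator (cball 0 r) x \<partial>\<mu>)"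
    by (intro nn_integral_cong) (use zero in \<open>auto simp: indicator_def\<close>)
  finally have "(\<integral>\<^sup>+x. ennreal (f x) \<partial>ball_measure r) \<le> (\<integral>\<^sup>+x. ennreal (g x) \<partial>ball_measure r)"
    by (simp add: nn_integral_ball_measure)
  then show ?thesis
    using f g by (simp add: nn_integral_eq_integral integrable_ball_measure integral_nonneg_AE ennreal_le_iff)
qed

text \<open>Expanding \<open>\<Phi>\<close> at the perturbed squared norm and comparing with the
  unperturbed integral forces the coefficient of \<open>\<epsilon>\<^sup>2\<close> to be nonpositive
  up to a slack \<open>\<delta>\<close>, which is then sent to 0.\<close>

theorem weighted_poincare_radial:
  fixes h :: "'a \<Rightarrow> real" and \<phi> \<psi> :: "real \<Rightarrow> real"
  assumes grad: "\<And>x. GDERIV h x :> grad_h x" and cont: "continuous_on UNIV grad_h"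
    and odd: "\<And>x. h (- x) = - h x"
    and d2: "\<And>s. (\<phi> has_real_derivative - \<psi> s) (at s)"
    and \<psi>: "continuous_on UNIV \<psi>" "\<And>s. \<psi> s \<ge> 0"
    and \<beta>: "\<beta> > 0" "\<And>s. \<beta> \<le> s \<Longrightarrow> \<phi> s = 0" "\<And>s. \<beta> \<le> s \<Longrightarrow> \<psi> s = 0"
  shows "(\<integral>\<^sup>+x. ennreal (2 * (\<psi> ((norm x)\<^sup>2) * (h x)\<^sup>2)) \<partial>\<mu>)
    \<le> (\<integral>\<^sup>+x. ennreal (\<phi> ((norm x)\<^sup>2) * (norm (grad_h x))\<^sup>2) \<partial>\<mu>)"
proof -
  have \<phi>_nonneg: "\<phi> s \<ge> 0" for s
    by (rule antiderivative_nonneg[OF d2 \<psi>(2) \<beta>(2)])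
  have c\<phi>: "continuous_on UNIV \<phi>"
    using d2 DERIV_isCont by (intro continuous_at_imp_continuous_on) auto
  obtain \<Phi> where d1: "\<And>s. (\<Phi> has_real_derivative - \<phi> s) (at s)" and \<Phi>_zero: "\<And>s. \<beta> \<le> s \<Longrightarrow> \<Phi> s = 0"
    using antiderivative_vanishing[OF c\<phi> \<beta>(2)] by blast
  have \<Phi>_anti: "\<Phi> t \<le> \<Phi> s" if "s \<le> t" for s t
    using that by (rule DERIV_nonpos_imp_nonincreasing) (use d1 \<phi>_nonneg in force)
  have \<Phi>_nonneg: "\<Phi> s \<ge> 0" for s
    by (rule antiderivative_nonneg[OF d1 \<phi>_nonneg \<Phi>_zero])
  have c\<Phi>: "continuous_on UNIV \<Phi>"
    using d1 DERIV_isCont by (intro continuous_at_imp_continuous_on) auto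

  \<comment> \<open>Outside this ball \<open>\<Phi>\<close>, \<open>\<phi>\<close> and
    \<open>\<psi>\<close> vanish at the squared norm, so restricting to it loses nothing.\<close>
  define r where "r = sqrt \<beta>"
  have r: "x \<notin> cball 0 r \<Longrightarrow> \<beta> \<le> (norm x)\<^sup>2" for x :: 'a
    using \<beta>(1) unfolding r_def by (auto simp: not_le real_sqrt_less_iff dest!: less_imp_le sqrt_le_D)
  let ?N = "ball_measure r"
  interpret N: finite_measure ?N by (rule finite_ball_measure)

  have h_cont: "continuous_on UNIV h"
    using grad unfolding gderiv_def by (intro continuous_at_imp_continuous_on) (auto intro: has_derivative_continuous)
  have cn: "continuous_on UNIV (\<lambda>x::'a. (norm x)\<^sup>2)" by (intro continuous_intros)
  let ?g = "\<lambda>x. (norm (grad_h x))\<^sup>2"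
  have cg: "continuous_on UNIV ?g" by (intro continuous_intros cont)
  have c\<psi>n: "continuous_on UNIV (\<lambda>x::'a. \<psi> ((norm x)\<^sup>2))"
    and c\<phi>n: "continuous_on UNIV (\<lambda>x::'a. \<phi> ((norm x)\<^sup>2))"
    and c\<Phi>n: "continuous_on UNIV (\<lambda>x::'a. \<Phi> ((norm x)\<^sup>2))"
    using continuous_on_compose2[OF \<psi>(1) cn] continuous_on_compose2[OF c\<phi> cn] continuous_on_compose2[OF c\<Phi> cn]
    by auto
  have cA: "continuous_on UNIV (\<lambda>x. \<psi> ((norm x)\<^sup>2) * (h x)\<^sup>2)"
    by (intro continuous_on_mult continuous_on_power c\<psi>n h_cont)
  have cB: "continuous_on UNIV (\<lambda>x. \<phi> ((norm x)\<^sup>2) * ?g x)"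
    by (intro continuous_on_mult c\<phi>n cg)
  have cH: "continuous_on UNIV (\<lambda>x. \<phi> ((norm x)\<^sup>2) * h x)"
    by (intro continuous_on_mult c\<phi>n h_cont)
  define A where "A = (\<integral>x. \<psi> ((norm x)\<^sup>2) * (h x)\<^sup>2 \<partial>?N)"
  define B where "B = (\<integral>x. \<phi> ((norm x)\<^sup>2) * ?g x \<partial>?N)"
  define P where "P = (\<integral>x. \<phi> ((norm x)\<^sup>2) \<partial>?N)"
  have P: "P \<ge> 0" unfolding P_def using \<phi>_nonneg by simp
  have odd0: "(\<integral>x. \<phi> ((norm x)\<^sup>2) * h x \<partial>?N) = 0"
    by (rule integral_odd_ball_measure) (auto simp: odd intro: borel_measurable_continuous_onI cH)

  obtain C where C: "\<And>x. x \<in> cball 0 r \<Longrightarrow> \<bar>h x\<bar> \<le> C" "\<And>x. x \<in> cball 0 r \<Longrightarrow> \<bar>?g x\<bar> \<le> C"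
  proof -
    have "bounded (h ` cball 0 r)" "bounded (?g ` cball 0 r)"
      by (intro compact_imp_bounded compact_continuous_image continuous_on_subset[OF h_cont] continuous_on_subset[OF cg]; simp)+
    then obtain C1 C2 where "\<And>x. x \<in> cball 0 r \<Longrightarrow> \<bar>h x\<bar> \<le> C1" "\<And>x. x \<in> cball 0 r \<Longrightarrow> \<bar>?g x\<bar> \<le> C2"
      unfolding bounded_iff by fastforce
    then show ?thesis using that[of "max C1 C2"] by (simp add: le_max_iff_disj)
  qed

  have main: "2 * A - B \<le> \<delta> * (P + measure ?N UNIV)" if \<delta>: "\<delta> > 0" for \<delta>
  proof -
    \<comment> \<open>The same \<open>\<delta>\<close> is the slack of the midpoint estimate,
      contributing \<open>\<delta> * P\<close>, and the Taylor error, contributing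
      \<open>\<delta>\<close> times the mass of the ball.\<close>
    define q where "q = (\<lambda>\<epsilon> x. (norm x)\<^sup>2 - 2 * \<epsilon> * h x + \<epsilon>\<^sup>2 * (?g x + \<delta>))"
    obtain \<epsilon>1 where \<epsilon>1: "\<epsilon>1 > 0" "\<And>\<epsilon> x y. 0 < \<epsilon> \<Longrightarrow> \<epsilon> < \<epsilon>1 \<Longrightarrow> x \<in> cball 0 r \<Longrightarrow> y \<in> cball 0 r \<Longrightarrow>
        (norm ((1/2) *\<^sub>R (x - y)))\<^sup>2 \<le> (q \<epsilon> x + q \<epsilon> y) / 2"
      using perturbed_norm_midpoint[OF grad cont odd \<delta>, of r] unfolding q_def by blast
    have hC: "\<bar>h x\<bar> \<le> C + \<delta>" and gC: "\<bar>?g x + \<delta>\<bar> \<le> C + \<delta>" if "x \<in> cball 0 r" for x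
      using C[OF that] \<delta> by auto
    obtain \<epsilon>2 where \<epsilon>2: "\<epsilon>2 > 0" "\<And>\<epsilon> x. 0 < \<epsilon> \<Longrightarrow> \<epsilon> < \<epsilon>2 \<Longrightarrow> x \<in> cball 0 r \<Longrightarrow>
        \<Phi> ((norm x)\<^sup>2) + 2 * \<epsilon> * (\<phi> ((norm x)\<^sup>2) * h x)
          + \<epsilon>\<^sup>2 * (2 * (\<psi> ((norm x)\<^sup>2) * (h x)\<^sup>2) - \<phi> ((norm x)\<^sup>2) * (?g x + \<delta>) - \<delta>) \<le> \<Phi> (q \<epsilon> x)"
      using taylor_perturbed_norm[of \<Phi> \<phi> \<psi> r h "C + \<delta>" "\<lambda>x. ?g x + \<delta>" \<delta>, OF d1 d2 \<psi> hC gC \<delta>]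
      unfolding q_def by blast
    define \<epsilon> where "\<epsilon> = min \<epsilon>1 \<epsilon>2 / 2"
    have \<epsilon>: "0 < \<epsilon>" "\<epsilon> < \<epsilon>1" "\<epsilon> < \<epsilon>2" using \<epsilon>1(1) \<epsilon>2(1) by (auto simp: \<epsilon>_def)
    have cq: "continuous_on UNIV (q \<epsilon>)"
      unfolding q_def by (intro continuous_on_add continuous_on_diff continuous_on_mult continuous_on_const cn h_cont cg)
    have c\<Phi>q: "continuous_on UNIV (\<lambda>x. \<Phi> (q \<epsilon> x))"
      using continuous_on_compose2[OF c\<Phi> cq] by simp
    let ?T = "\<lambda>x. \<Phi> ((norm x)\<^sup>2) + 2 * \<epsilon> * (\<phi> ((norm x)\<^sup>2) * h x)
        + \<epsilon>\<^sup>2 * (2 * (\<psi> ((norm x)\<^sup>2) * (h x)\<^sup>2) - \<phi> ((norm x)\<^sup>2) * ?g x - \<delta> * \<phi> ((norm x)\<^sup>2) - \<delta>)"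
    note int = integrable_ball_measure[OF cA] integrable_ball_measure[OF cB] integrable_ball_measure[OF cH]
      integrable_ball_measure[OF c\<phi>n] integrable_ball_measure[OF c\<Phi>n] integrable_ball_measure[OF c\<Phi>q]
    have "(\<integral>x. \<Phi> ((norm x)\<^sup>2) \<partial>?N) + \<epsilon>\<^sup>2 * (2 * A - B - \<delta> * P - \<delta> * measure ?N UNIV) = (\<integral>x. ?T x \<partial>?N)"
      using int odd0 by (simp add: A_def B_def P_def)
    also have "\<dots> \<le> (\<integral>x. \<Phi> (q \<epsilon> x) \<partial>?N)"
    proof (rule integral_mono_AE)
      show "AE x in ?N. ?T x \<le> \<Phi> (q \<epsilon> x)"
        using AE_ball_measure[of r]
      proof eventually_elim
        case (elim x)
        show ?case using \<epsilon>2(2)[OF \<epsilon>(1,3) elim] by (simp add: algebra_simps)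
      qed
    qed (use int in auto)
    also have "\<dots> \<le> (\<integral>x. \<Phi> ((norm x)\<^sup>2) \<partial>?N)"
    proof (rule integral_mono_of_midpoint)
      fix x y :: 'a assume xy: "x \<in> cball 0 r" "y \<in> cball 0 r"
      \<comment> \<open>An average is at most the maximum, and the decreasing \<open>\<Phi>\<close>
        sends a maximum to a minimum.\<close>
      have "(norm ((1/2) *\<^sub>R (x - y)))\<^sup>2 \<le> max (q \<epsilon> x) (q \<epsilon> y)"
        using \<epsilon>1(2)[OF \<epsilon>(1,2) xy] by (simp add: max_def field_simps split: if_splits)
      from \<Phi>_anti[OF this] show "min (\<Phi> (q \<epsilon> x)) (\<Phi> (q \<epsilon> y)) \<le> \<Phi> ((norm ((1/2) *\<^sub>R (x - y)))\<^sup>2)"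
        by (auto simp: max_def min_def split: if_splits)
    qed (use c\<Phi>q c\<Phi>n \<Phi>_nonneg \<Phi>_zero r in auto)
    finally have "\<epsilon>\<^sup>2 * (2 * A - B - \<delta> * P - \<delta> * measure ?N UNIV) \<le> 0" by simp
    then have "2 * A - B - \<delta> * P - \<delta> * measure ?N UNIV \<le> 0"
      using \<epsilon>(1) by (simp add: mult_le_0_iff)
    then show ?thesis by (simp add: algebra_simps)
  qed
  have "2 * A \<le> B"
  proof (rule ccontr)
    assume "\<not> 2 * A \<le> B"
    \<comment> \<open>The summand 1 makes \<open>c\<close> positive even if the ball has measure 0;
      \<open>\<delta>\<close> is chosen so that \<open>\<delta> * c\<close> is half of the supposed
      gap.\<close>
    define c where "c = P + measure ?N UNIV + 1"
    have c: "c > 0" using P measure_nonneg[of ?N UNIV] unfolding c_def by linarith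
    define \<delta> where "\<delta> = (2 * A - B) / (2 * c)"
    have \<delta>: "\<delta> > 0" using \<open>\<not> 2 * A \<le> B\<close> c by (simp add: \<delta>_def)
    have "2 * A - B \<le> \<delta> * (P + measure ?N UNIV)" by (rule main[OF \<delta>])
    also have "\<dots> \<le> \<delta> * c" using \<delta> by (intro mult_left_mono) (auto simp: c_def)
    also have "\<delta> * c = (2 * A - B) / 2" using c by (simp add: \<delta>_def)
    finally show False using \<open>\<not> 2 * A \<le> B\<close> by simp
  qed
  have restrict: "(\<integral>\<^sup>+x. ennreal (f x) \<partial>\<mu>) = ennreal (\<integral>x. f x \<partial>?N)"
    if "continuous_on UNIV f" "\<And>x. f x \<ge> 0" "\<And>x. x \<notin> cball 0 r \<Longrightarrow> f x = 0" for f
  proof -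
    have "(\<integral>\<^sup>+x. ennreal (f x) \<partial>\<mu>) = (\<integral>\<^sup>+x. ennreal (f x) * indicator (cball 0 r) x \<partial>\<mu>)"
      by (intro nn_integral_cong) (use that in \<open>auto simp: indicator_def\<close>)
    also have "\<dots> = (\<integral>\<^sup>+x. ennreal (f x) \<partial>?N)"
      using that by (subst nn_integral_ball_measure) (auto intro!: measurable_compose[OF _ measurable_ennreal] borel_measurable_continuous_onI)
    also have "\<dots> = ennreal (\<integral>x. f x \<partial>?N)"
      using that by (intro nn_integral_eq_integral integrable_ball_measure) auto
    finally show ?thesis .
  qed
  have "(\<integral>\<^sup>+x. ennreal (2 * (\<psi> ((norm x)\<^sup>2) * (h x)\<^sup>2)) \<partial>\<mu>) = ennreal (2 * A)"
    using restrict[of "\<lambda>x. 2 * (\<psi> ((norm x)\<^sup>2) * (h x)\<^sup>2)"] continuous_on_mult[OF continuous_on_const cA, of 2] \<psi>(2) \<beta>(3) r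
    by (simp add: A_def)
  moreover have "(\<integral>\<^sup>+x. ennreal (\<phi> ((norm x)\<^sup>2) * ?g x) \<partial>\<mu>) = ennreal B"
    using restrict[OF cB] \<phi>_nonneg \<beta>(2) r by (simp add: B_def)
  ultimately show ?thesis using \<open>2 * A \<le> B\<close> by (simp add: ennreal_leI)
qed

end

section \<open>Log-concave measures\<close>

lemma convex_on_finite_part:
  assumes conv: "ext_convex v" and S: "convex S" "\<And>x. x \<in> S \<Longrightarrow> v x \<noteq> \<infinity>"
  shows "convex_on S (\<lambda>x. real_of_ereal (v x))"
proof (rule convex_onI)
  fix t :: real and x y assume t: "0 < t" "t < 1" and xy: "x \<in> S" "y \<in> S"
  let ?z = "(1 - t) *\<^sub>R x + t *\<^sub>R y"
  have z: "?z \<in> S" using convexD_alt[OF S(1) xy, of t] t by simp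
  have "v ?z \<le> ereal (1 - t) * v x + ereal t * v y"
    using conv t unfolding ext_convex_def by auto
  moreover have "v u = ereal (real_of_ereal (v u))" if "u \<in> S" for u
    using S(2)[OF that] conv unfolding ext_convex_def by (cases "v u") auto
  ultimately have "ereal (real_of_ereal (v ?z)) \<le> ereal (1 - t) * ereal (real_of_ereal (v x)) + ereal t * ereal (real_of_ereal (v y))"
    using xy z by metis
  then show "real_of_ereal (v ?z) \<le> (1 - t) * real_of_ereal (v x) + t * real_of_ereal (v y)" by simp
qed (rule S(1))

text \<open>A convex function is continuous on the interior of its domain and the boundary of the domain is
  a null set, so discarding the boundary turns the density into a Borel function that is still
  log-concave.\<close>

lemma log_concave_wrt_density:
  fixes W :: "'a::euclidean_space \<Rightarrow> ennreal"
  assumes lc: "log_concave_wrt \<nu> (density lborel W)" and W [measurable]: "W \<in> borel_measurable borel"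
  obtains E where "E \<in> borel_measurable borel" "\<And>x y. E x * E y \<le> (E ((1/2) *\<^sub>R (x + y)))\<^sup>2"
    "\<nu> = density lborel (\<lambda>x. W x * E x)"
proof -
  let ?M = "density lborel W"
  obtain v where conv: "ext_convex v" and sets: "sets \<nu> = sets borel"
    and \<nu>: "\<And>A. A \<in> sets borel \<Longrightarrow> emeasure \<nu> A = (\<integral>\<^sup>+x\<in>A. exp_minus (v x) \<partial>completion ?M)"
    using lc unfolding log_concave_wrt_def by auto
  define D where "D = {x. v x \<noteq> \<infinity>}"
  define U where "U = interior D"
  have "convex D"
  proof (rule convexI)
    fix x y and a b :: real assume xy: "x \<in> D" "y \<in> D" and ab: "0 \<le> a" "0 \<le> b" "a + b = 1"
    have "v ((1 - b) *\<^sub>R x + b *\<^sub>R y) \<le> ereal (1 - b) * v x + ereal b * v y"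
      using conv ab unfolding ext_convex_def by auto
    also have "\<dots> < \<infinity>" using xy conv by (cases "v x"; cases "v y") (auto simp: D_def ext_convex_def)
    also have "1 - b = a" using ab by simp
    finally show "a *\<^sub>R x + b *\<^sub>R y \<in> D" by (auto simp: D_def)
  qed
  then have U: "convex U" "open U" "U \<subseteq> D" by (auto simp: U_def convex_interior interior_subset)
  define f where "f = (\<lambda>x. real_of_ereal (v x))"
  have f: "convex_on U f"
    unfolding f_def by (rule convex_on_finite_part[OF conv U(1)]) (use U(3) in \<open>auto simp: D_def\<close>)
  define E where "E = (\<lambda>x. ennreal (indicator U x *\<^sub>R exp (- f x)))"
  have E_meas [measurable]: "E \<in> borel_measurable borel"
    unfolding E_def using convex_on_continuous[OF U(2) f] U(2)
    by (intro measurable_compose[OF _ measurable_ennreal] borel_measurable_continuous_on_indicator continuous_intros) auto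
  have E_mid: "E x * E y \<le> (E ((1/2) *\<^sub>R (x + y)))\<^sup>2" for x y
  proof (cases "x \<in> U \<and> y \<in> U")
    case True
    let ?z = "(1/2) *\<^sub>R (x + y)"
    have z: "?z = (1 - 1/2) *\<^sub>R x + (1/2) *\<^sub>R y" by (simp add: scaleR_add_right)
    have "?z \<in> U" unfolding z using True U(1) by (intro convexD_alt) auto
    moreover have "f ?z \<le> (1 - 1/2) * f x + (1/2) * f y"
      unfolding z using True f by (intro convex_onD) auto
    then have "exp (- f x) * exp (- f y) \<le> (exp (- f ?z))\<^sup>2"
      by (simp add: power2_eq_square flip: exp_add)
    ultimately show ?thesis using True
      by (simp add: E_def ennreal_power ennreal_leI flip: ennreal_mult)
  qed (auto simp: E_def indicator_def)
  have "AE x in lborel. x \<notin> frontier D"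
  proof -
    have "frontier D \<in> null_sets lebesgue"
      using negligible_convex_frontier[OF \<open>convex D\<close>] by (simp add: negligible_iff_null_sets)
    then show ?thesis using AE_not_in AE_completion_iff by blast
  qed
  then have "AE x in lborel. exp_minus (v x) = E x"
  proof eventually_elim
    case (elim x)
    show ?case
    proof (cases "x \<in> U")
      case True
      then show ?thesis using U(3) by (auto simp: E_def f_def exp_minus_def D_def)
    next
      case False
      \<comment> \<open>Off the frontier, a point outside the interior lies outside the
        closure.\<close>
      with elim have "x \<notin> D" using closure_subset by (auto simp: frontier_def U_def)
      then show ?thesis using False by (simp add: E_def exp_minus_def D_def)
    qed
  qed
  then have ae: "AE x in completion ?M. exp_minus (v x) = E x"
    by (auto simp: AE_completion_iff AE_density)
  have "\<nu> = density lborel (\<lambda>x. W x * E x)"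
  proof (rule measure_eqI)
    fix A assume "A \<in> sets \<nu>"
    then have A [measurable]: "A \<in> sets borel" using sets by simp
    have "emeasure \<nu> A = (\<integral>\<^sup>+x\<in>A. E x \<partial>completion ?M)"
      unfolding \<nu>[OF A] by (intro nn_integral_cong_AE) (use ae in eventually_elim, simp)
    also have "\<dots> = (\<integral>\<^sup>+x. W x * (E x * indicator A x) \<partial>lborel)"
      unfolding nn_integral_completion by (subst nn_integral_density) auto
    also have "\<dots> = emeasure (density lborel (\<lambda>x. W x * E x)) A"
      by (subst emeasure_density) (auto simp: mult.assoc)
    finally show "emeasure \<nu> A = emeasure (density lborel (\<lambda>x. W x * E x)) A" .
  qed (simp add: sets)
  with E_meas E_mid that show ?thesis by blast
qed

section \<open>Radial functions and cutoffs away from the origin and infinity\<close>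

text \<open>Nothing is known about \<open>g 0\<close>, so the origin is split off as a single
  point.\<close>

lemma borel_measurable_radial:
  fixes g :: "real \<Rightarrow> real"
  assumes "continuous_on {0<..} g"
  shows "(\<lambda>x::'a::euclidean_space. g (norm x)) \<in> borel_measurable borel"
proof -
  have "(\<lambda>x::'a. if x \<in> {0} then g 0 else g (norm x)) \<in> borel_measurable borel"
    by (rule borel_measurable_continuous_on_if)
       (auto intro!: continuous_on_compose2[OF assms] continuous_intros)
  also have "(\<lambda>x::'a. if x \<in> {0} then g 0 else g (norm x)) = (\<lambda>x. g (norm x))" by auto
  finally show ?thesis .
qed

text \<open>For \<open>n \<ge> 2\<close> this is piecewise linear in \<open>s\<close>: 0 up to
  \<open>1 / n\<close>, 1 from \<open>2 / n\<close> to \<open>n\<close>, and 0 again from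
  \<open>n + 1\<close> on. Continuity suffices, since it multiplies a second derivative.\<close>

definition cutoff :: "nat \<Rightarrow> real \<Rightarrow> real" where
  "cutoff n s = max 0 (min 1 (min (real n * s - 1) (real n + 1 - s)))"

lemma cutoff_bounds: "0 \<le> cutoff n s" "cutoff n s \<le> 1"
  by (auto simp: cutoff_def)

lemma cutoff_mono: "0 \<le> s \<Longrightarrow> m \<le> n \<Longrightarrow> cutoff m s \<le> cutoff n s"
  unfolding cutoff_def by (intro max.mono min.mono order_refl diff_mono mult_right_mono add_mono) auto

text \<open>The threshold \<open>1 / (n + 1)\<close> makes sense for \<open>n = 0\<close> too. Its
  positivity lets the open half-line of zeros overlap \<open>{0<..}\<close>.\<close>

lemma cutoff_eq_0: "s < 1 / (real n + 1) \<Longrightarrow> cutoff n s = 0" "real n + 1 \<le> s \<Longrightarrow> cutoff n s = 0"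
proof -
  assume s: "s < 1 / (real n + 1)"
  have "real n * s \<le> 1"
  proof (cases "s \<le> 0")
    case True
    then have "real n * s \<le> 0" by (simp add: mult_nonneg_nonpos)
    then show ?thesis by simp
  next
    case False
    then have "real n * s \<le> (real n + 1) * s" by simp
    also have "\<dots> \<le> 1" using s by (simp add: field_simps)
    finally show ?thesis .
  qed
  then show "cutoff n s = 0" by (simp add: cutoff_def)
qed (simp add: cutoff_def)

lemma cutoff_eventually_1:
  assumes "s > 0"
  shows "\<exists>n. cutoff n s = 1"
proof -
  obtain n where "max s (2 / s) \<le> real n" using real_arch_simple by blast
  then have "s \<le> real n" "2 \<le> real n * s" using assms by (auto simp: field_simps)
  then show ?thesis by (intro exI[of _ n]) (simp add: cutoff_def)
qed

text \<open>Gluing over two open sets covering the line: on one \<open>p\<close> is continuous, on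
  the other the product is 0 whatever \<open>p\<close> is.\<close>

lemma continuous_on_cutoff_mult:
  assumes "continuous_on {0<..} p"
  shows "continuous_on UNIV (\<lambda>s. cutoff n s * p s)"
proof -
  have "continuous_on ({0<..} \<union> {..<1 / (real n + 1)}) (\<lambda>s. cutoff n s * p s)"
  proof (rule continuous_on_open_Un)
    show "continuous_on {0<..} (\<lambda>s. cutoff n s * p s)"
      unfolding cutoff_def by (intro continuous_intros assms)
    have "continuous_on {..<1 / (real n + 1)} (\<lambda>s. 0::real)" by simp
    then show "continuous_on {..<1 / (real n + 1)} (\<lambda>s. cutoff n s * p s)"
      by (rule continuous_on_eq) (simp add: cutoff_eq_0)
  qed auto
  moreover have "{0<..} \<union> {..<1 / (real n + 1)} = (UNIV :: real set)"
    using less_le_trans[of _ 0 "1 / (real n + 1)"] by (force simp: not_less)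
  ultimately show ?thesis by simp
qed

section \<open>Cutting off the radial weight and passing to the limit\<close>

theorem theorem4:
  fixes w w' :: "real \<Rightarrow> real"
    and \<nu> :: "(real ^ 'n) measure"
    and h :: "real ^ 'n \<Rightarrow> real"
    and grad_h :: "real ^ 'n \<Rightarrow> real ^ 'n"
  assumes w_deriv: "\<And>r. r > 0 \<Longrightarrow> (w has_real_derivative w' r) (at r)"
    and w'_cont: "continuous_on {0<..} w'"
    and w_mono: "mono_on {0<..} w"
    and \<nu>_finite: "finite_measure \<nu>"
    and \<nu>_even: "even_measure \<nu>"
    and \<nu>_log_concave:
      "log_concave_wrt \<nu> (density lborel (\<lambda>x. ennreal (exp (- w (norm x)))))"
    and h_grad: "\<And>x. GDERIV h x :> grad_h x"
    and grad_h_cont: "continuous_on UNIV grad_h"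
    and h_odd: "\<And>x. h (- x) = - h x"
  shows "(\<integral>\<^sup>+x. ennreal (w' (norm x) / norm x * (h x)\<^sup>2) \<partial>\<nu>)
       \<le> (\<integral>\<^sup>+x. ennreal ((norm (grad_h x))\<^sup>2) \<partial>\<nu>)"
proof -
  have w_cont: "continuous_on {0<..} w"
    using w_deriv DERIV_isCont by (intro continuous_at_imp_continuous_on) auto
  have w'_nonneg: "w' r \<ge> 0" if "r > 0" for r
    using mono_on_imp_deriv_nonneg[OF w_mono w_deriv[OF that]] that by (simp add: interior_open)
  note [measurable] = borel_measurable_radial[OF w_cont] borel_measurable_radial[OF w'_cont]
  have h_cont: "continuous_on UNIV h"
    using h_grad unfolding gderiv_def
    by (intro continuous_at_imp_continuous_on) (auto intro: has_derivative_continuous)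
  have [measurable]: "h \<in> borel_measurable borel" "grad_h \<in> borel_measurable borel"
    using h_cont grad_h_cont by (auto intro: borel_measurable_continuous_onI)
  let ?W = "\<lambda>x :: real ^ 'n. ennreal (exp (- w (norm x)))"
  obtain E where [measurable]: "E \<in> borel_measurable borel"
    and E_mid: "\<And>x y. E x * E y \<le> (E ((1/2) *\<^sub>R (x + y)))\<^sup>2"
    and \<nu>: "\<nu> = density lborel (\<lambda>x. ?W x * E x)"
    using log_concave_wrt_density[OF \<nu>_log_concave] by auto
  have sets_\<nu> [simp, measurable_cong]: "sets \<nu> = sets borel" by (simp add: \<nu>)
  \<comment> \<open>Dividing out the radial weight leaves the even log-concave measure to which the
    comparison applies; the weight returns as the factor \<open>?W\<close> in the integrand.\<close>
  define \<mu> where "\<mu> = density lborel E"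
  have \<mu>_\<nu>: "\<mu> = density \<nu> (\<lambda>x. ennreal (exp (w (norm x))))"
  proof -
    have "?W x * E x * ennreal (exp (w (norm x))) = E x" for x
    proof -
      have "?W x * ennreal (exp (w (norm x))) = 1" by (simp flip: ennreal_mult exp_add)
      then show ?thesis by (metis mult.assoc mult.commute mult_1)
    qed
    then show ?thesis unfolding \<nu> \<mu>_def by (subst density_density_eq) auto
  qed
  have \<nu>_\<mu>: "(\<integral>\<^sup>+x. f x \<partial>\<nu>) = (\<integral>\<^sup>+x. ?W x * f x \<partial>\<mu>)" if [measurable]: "f \<in> borel_measurable borel" for f
    unfolding \<nu> \<mu>_def by (subst (1 2) nn_integral_density) (auto simp: mult_ac)
  \<comment> \<open>\<open>w\<close> is controlled at positive radii only, so the origin is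
    discarded as a null set.\<close>
  have ae_\<nu>: "AE x in \<nu>. x \<noteq> 0"
    unfolding \<nu> by (subst AE_density) (use AE_lborel_singleton[of "0 :: real ^ 'n"] in auto)
  have ae_\<mu>: "AE x in \<mu>. x \<noteq> 0"
    unfolding \<mu>_def by (subst AE_density) (use AE_lborel_singleton[of "0 :: real ^ 'n"] in auto)
  interpret even_log_concave E \<mu>
  proof
    fix A :: "(real ^ 'n) set" assume A [measurable]: "A \<in> sets borel"
    have vim: "uminus -` B = uminus ` B" for B :: "(real ^ 'n) set" by force
    have "distr \<nu> borel uminus = \<nu>"
      by (rule measure_eqI) (use \<nu>_even in \<open>auto simp: emeasure_distr vim even_measure_def \<nu>\<close>)
    then have "emeasure \<mu> A = (\<integral>\<^sup>+x. ennreal (exp (w (norm x))) * indicator A x \<partial>distr \<nu> borel uminus)"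
      unfolding \<mu>_\<nu> by (subst emeasure_density) auto
    also have "\<dots> = (\<integral>\<^sup>+x. ennreal (exp (w (norm x))) * indicator (uminus -` A) x \<partial>\<nu>)"
      by (subst nn_integral_distr) (auto simp: indicator_def)
    also have "\<dots> = emeasure \<mu> (uminus -` A)"
      unfolding \<mu>_\<nu> using measurable_sets[of uminus borel borel A] by (subst emeasure_density) auto
    finally show "emeasure \<mu> (uminus -` A) = emeasure \<mu> A" ..
  next
    fix r :: real
    \<comment> \<open>On the punctured ball the increasing \<open>w\<close> is at most
      \<open>w R\<close>; the lower bound 1 keeps \<open>R\<close> positive for every
      \<open>r\<close>.\<close>
    define R where "R = max r 1"
    have "emeasure \<mu> (cball 0 r) = (\<integral>\<^sup>+x. ennreal (exp (w (norm x))) * indicator (cball 0 r) x \<partial>\<nu>)"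
      unfolding \<mu>_\<nu> by (subst emeasure_density) auto
    also have "\<dots> \<le> (\<integral>\<^sup>+x. ennreal (exp (w R)) \<partial>\<nu>)"
    proof (rule nn_integral_mono_AE)
      show "AE x in \<nu>. ennreal (exp (w (norm x))) * indicator (cball 0 r) x \<le> ennreal (exp (w R))"
        using ae_\<nu>
      proof eventually_elim
        case (elim x)
        have "w (norm x) \<le> w R" if "norm x \<le> r"
          using that elim by (intro mono_onD[OF w_mono]) (auto simp: R_def)
        then show ?case by (auto simp: indicator_def intro: ennreal_leI)
      qed
    qed
    also have "\<dots> < \<infinity>"
      using finite_measure.emeasure_finite[OF \<nu>_finite, of "space \<nu>"] by (simp add: ennreal_mult_less_top less_top)
    finally show "emeasure \<mu> (cball 0 r) < \<infinity>" .
  qed (use E_mid in \<open>auto simp: \<mu>_def\<close>)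

  define k where "k = (\<lambda>x :: real ^ 'n. w' (norm x) / norm x * (h x)\<^sup>2)"
  \<comment> \<open>At the origin the quotient is 0 by the convention for division by zero, whatever
    \<open>w' 0\<close> is.\<close>
  have k_nonneg: "k x \<ge> 0" for x using w'_nonneg[of "norm x"] by (cases "x = 0") (auto simp: k_def)
  have [measurable]: "k \<in> borel_measurable borel" unfolding k_def by measurable
  have cm [measurable]: "cutoff n \<in> borel_measurable borel" for n unfolding cutoff_def by measurable
  \<comment> \<open>\<open>p\<close> is minus the derivative of \<open>exp (- w (sqrt s))\<close>,
    the limiting choice of \<open>\<phi>\<close>.\<close>
  define p where "p = (\<lambda>s. w' (sqrt s) / (2 * sqrt s) * exp (- w (sqrt s)))"
  have p_cont: "continuous_on {0<..} p"
    unfolding p_def by (intro continuous_intros continuous_on_compose2[OF w'_cont] continuous_on_compose2[OF w_cont]) auto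
  have p_nonneg: "p s \<ge> 0" if "s > 0" for s
    using w'_nonneg[of "sqrt s"] that by (simp add: p_def)
  have bound: "(\<integral>\<^sup>+x. ennreal (cutoff n ((norm x)\<^sup>2) * k x) \<partial>\<nu>) \<le> (\<integral>\<^sup>+x. ennreal ((norm (grad_h x))\<^sup>2) \<partial>\<nu>)" for n
  proof -
    \<comment> \<open>Cutting off the derivative and integrating back keeps \<open>\<psi>\<close>
      nonnegative and, because \<open>\<psi> \<le> p\<close>, keeps \<open>\<phi>\<close> below its
      limit.\<close>
    define \<psi> where "\<psi> = (\<lambda>s. cutoff n s * p s)"
    have \<psi>_cont: "continuous_on UNIV \<psi>"
      unfolding \<psi>_def by (rule continuous_on_cutoff_mult[OF p_cont])
    have \<psi>_nonneg: "\<psi> s \<ge> 0" for s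
    proof (cases "s > 0")
      case False
      then have "s < 1 / (real n + 1)" by (smt (verit) divide_pos_pos of_nat_0_le_iff)
      then show ?thesis by (simp add: \<psi>_def cutoff_eq_0)
    qed (simp add: \<psi>_def p_nonneg cutoff_bounds)
    have \<psi>_zero: "\<psi> s = 0" if "real n + 1 \<le> s" for s using that by (simp add: \<psi>_def cutoff_eq_0)
    obtain \<phi> where \<phi>: "\<And>s. (\<phi> has_real_derivative - \<psi> s) (at s)" and \<phi>_zero: "\<And>s. real n + 1 \<le> s \<Longrightarrow> \<phi> s = 0"
      using antiderivative_vanishing[OF \<psi>_cont \<psi>_zero] by blast
    have \<phi>_le: "\<phi> s \<le> exp (- w (sqrt s))" if s: "s > 0" for s
    proof -
      \<comment> \<open>The derivative of \<open>G\<close> is \<open>\<psi> - p \<le> 0\<close>, and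
        \<open>G\<close> is nonnegative at \<open>?t\<close>, where \<open>\<phi>\<close> vanishes;
        hence \<open>G\<close> is nonnegative at \<open>s\<close>.\<close>
      define G where "G = (\<lambda>s. exp (- w (sqrt s)) - \<phi> s)"
      let ?t = "max s (real n + 1)"
      have "G ?t \<le> G s"
      proof (rule DERIV_nonpos_imp_nonincreasing[of s ?t G])
        fix u assume "s \<le> u"
        with s have u: "u > 0" by simp
        have "((\<lambda>s. w (sqrt s)) has_real_derivative w' (sqrt u) * (inverse (sqrt u) / 2)) (at u)"
          by (rule DERIV_chain2[OF w_deriv DERIV_real_sqrt]) (use u in auto)
        then have "(G has_real_derivative exp (- w (sqrt u)) * - (w' (sqrt u) * (inverse (sqrt u) / 2)) - - \<psi> u) (at u)"
          unfolding G_def by (intro DERIV_diff DERIV_fun_exp DERIV_minus \<phi>)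
        moreover have "exp (- w (sqrt u)) * - (w' (sqrt u) * (inverse (sqrt u) / 2)) = - p u"
          by (simp add: p_def field_simps)
        moreover have "\<psi> u \<le> p u"
          using mult_right_mono[OF cutoff_bounds(2)[of n u] p_nonneg[OF u]] by (simp add: \<psi>_def)
        ultimately show "\<exists>y. (G has_real_derivative y) (at u) \<and> y \<le> 0" by force
      qed simp
      moreover have "0 \<le> G ?t" using \<phi>_zero[of ?t] by (simp add: G_def)
      ultimately have "0 \<le> G s" by linarith
      then show ?thesis by (simp add: G_def)
    qed
    have "(\<integral>\<^sup>+x. ennreal (cutoff n ((norm x)\<^sup>2) * k x) \<partial>\<nu>) = (\<integral>\<^sup>+x. ennreal (2 * (\<psi> ((norm x)\<^sup>2) * (h x)\<^sup>2)) \<partial>\<mu>)"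
    proof (subst \<nu>_\<mu>, measurable, intro nn_integral_cong)
      fix x :: "real ^ 'n"
      \<comment> \<open>The 1/2 from differentiating the square root cancels the factor 2; at the
        origin both sides are 0.\<close>
      have "exp (- w (norm x)) * (cutoff n ((norm x)\<^sup>2) * k x) = 2 * (\<psi> ((norm x)\<^sup>2) * (h x)\<^sup>2)"
        by (simp add: \<psi>_def p_def k_def)
      then show "?W x * ennreal (cutoff n ((norm x)\<^sup>2) * k x) = ennreal (2 * (\<psi> ((norm x)\<^sup>2) * (h x)\<^sup>2))"
        by (simp add: k_nonneg cutoff_bounds flip: ennreal_mult)
    qed
    also have "\<dots> \<le> (\<integral>\<^sup>+x. ennreal (\<phi> ((norm x)\<^sup>2) * (norm (grad_h x))\<^sup>2) \<partial>\<mu>)"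
      by (rule weighted_poincare_radial[where \<beta> = "real n + 1"])
         (use h_grad grad_h_cont h_odd \<phi> \<psi>_cont \<psi>_nonneg \<phi>_zero \<psi>_zero in auto)
    also have "\<dots> \<le> (\<integral>\<^sup>+x. ?W x * ennreal ((norm (grad_h x))\<^sup>2) \<partial>\<mu>)"
    proof (rule nn_integral_mono_AE)
      show "AE x in \<mu>. ennreal (\<phi> ((norm x)\<^sup>2) * (norm (grad_h x))\<^sup>2) \<le> ?W x * ennreal ((norm (grad_h x))\<^sup>2)"
        using ae_\<mu>
      proof eventually_elim
        case (elim x)
        then have "\<phi> ((norm x)\<^sup>2) * (norm (grad_h x))\<^sup>2 \<le> exp (- w (norm x)) * (norm (grad_h x))\<^sup>2"
          using \<phi>_le[of "(norm x)\<^sup>2"] by (intro mult_right_mono) auto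
        then show ?case by (simp add: ennreal_leI flip: ennreal_mult)
      qed
    qed
    also have "\<dots> = (\<integral>\<^sup>+x. ennreal ((norm (grad_h x))\<^sup>2) \<partial>\<nu>)" by (subst \<nu>_\<mu>) auto
    finally show ?thesis .
  qed
  \<comment> \<open>At each nonzero \<open>x\<close> some cutoff equals 1, and at the origin
    \<open>k\<close> is 0, so monotone convergence gives the full left-hand integral.\<close>
  have "ennreal (k x) = (SUP n. ennreal (cutoff n ((norm x)\<^sup>2) * k x))" for x
  proof (cases "x = 0")
    case False
    then obtain n where "cutoff n ((norm x)\<^sup>2) = 1" using cutoff_eventually_1[of "(norm x)\<^sup>2"] by auto
    then have "ennreal (k x) \<le> (SUP n. ennreal (cutoff n ((norm x)\<^sup>2) * k x))"
      by (intro SUP_upper2[of n]) auto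
    moreover have "cutoff n ((norm x)\<^sup>2) * k x \<le> k x" for n
      using mult_right_mono[OF cutoff_bounds(2) k_nonneg] by simp
    ultimately show ?thesis by (intro antisym SUP_least) (auto intro: ennreal_leI)
  qed (simp add: k_def)
  then have "(\<integral>\<^sup>+x. ennreal (k x) \<partial>\<nu>) = (\<integral>\<^sup>+x. (SUP n. ennreal (cutoff n ((norm x)\<^sup>2) * k x)) \<partial>\<nu>)" by simp
  also have "\<dots> = (SUP n. \<integral>\<^sup>+x. ennreal (cutoff n ((norm x)\<^sup>2) * k x) \<partial>\<nu>)"
    by (rule nn_integral_monotone_convergence_SUP)
       (auto simp: incseq_def le_fun_def intro!: ennreal_leI mult_right_mono cutoff_mono k_nonneg)
  also have "\<dots> \<le> (\<integral>\<^sup>+x. ennreal ((norm (grad_h x))\<^sup>2) \<partial>\<nu>)" using bound by (intro SUP_least) auto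
  finally show ?thesis by (simp add: k_def)
qed

end
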